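(* Let $\beta\in[1,\infty)$ and let $\phi$ be a state of $\mathcal{T}(\mathrm{P}\rtimes\mathbb{N}^{\times})$ which is a $\mathrm{KMS}_\beta$ state for $\sigma$. Let $a,b\in\mathbb{N}^{\times}$ and $m,n\in\mathrm{P}$, and write $m=2x_1+3y_1$, $n=2x_2+3y_2$ with $x_1,x_2,y_1,y_2\in\mathbb{N}$. Then: (i) if $a\neq b$ or $m\not\equiv n \pmod a$, then $\phi(s^{x_1}t^{y_1}\upsilon_a\upsilon_b^{*}t^{*y_2}s^{*x_2})=0$; (ii) if $a=b$ and $m\equiv n\pmod a$, then there is $u\in\mathbb{Z}$ such that $a$ divides both $y_1-y_2+2u$ and $x_1-x_2-3u$, and $$\phi(s^{x_1}t^{y_1}\upsilon_a\upsilon_b^{*}t^{*y_2}s^{*x_2})=a^{-\beta}\,\phi\Big(t^{((\frac{y_1-y_2+2u}{a}))}\,s^{((\frac{x_1-x_2-3u}{a}))}\Big).$$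
   Context: $\mathbb{N}=\{0,1,2,\dots\}$, $\mathbb{N}^{\times}$ is the multiplicative semigroup of positive integers, and $\mathrm{P}=\{0,2,3,4,\dots\}$ is an additive semigroup. $\mathrm{P}\rtimes\mathbb{N}^{\times}$ is the semigroup of pairs $(m,a)$, $m\in \mathrm{P}$, $a\in\mathbb{N}^\times$, with product $(m,a)(n,b)=(m+an,ab)$ and unit $(0,1)$. For $(m,a),(n,b)\in\mathrm{P}\rtimes\mathbb{N}^{\times}$ put $(m,a)\Cup(n,b)=\infty$ if $(m+a\mathrm{P})\cap(n+b\mathrm{P})=\emptyset$, and otherwise $(m,a)\Cup(n,b)=(\ell,\mathrm{lcm}(a,b))$, where $\ell$ is the smallest element (usual order) of $(m+a\mathrm{P})\cap(n+b\mathrm{P})$. An isometric representation $W$ of $\mathrm{P}\rtimes\mathbb{N}^{\times}$ is a map into the isometries (on a Hilbert space, or in a unital $C^*$-algebra) with $W_{(0,1)}=1$ and $W_{xy}=W_xW_y$. It is covariant if $W_{(m,a)}W_{(m,a)}^*W_{(n,b)}W_{(n,b)}^*=W_{(m,a)\Cup(n,b)}W_{(m,a)\Cup(n,b)}^*$ for all $(m,a),(n,b)$, with the convention $W_\infty=0$. $\mathcal{T}(\mathrm{P}\rtimes\mathbb{N}^{\times})$ is the $C^*$-algebra generated by a covariant isometric representation $W:\mathrm{P}\rtimes\mathbb{N}^\times\to\mathcal{T}(\mathrm{P}\rtimes\mathbb{N}^{\times})$ (the canonical one) that is universal: for every covariant isometric representation $X$ there is a homomorphism $\pi:\mathcal{T}(\mathrm{P}\rtimes\mathbb{N}^{\times})\to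 C^*(\{X_{(m,a)}\})$ with $\pi(W_{(m,a)})=X_{(m,a)}$. Write $s=W_{(2,1)}$, $t=W_{(3,1)}$, $\upsilon_a=W_{(0,a)}$ for $a\in\mathbb{N}^\times$ (so $\upsilon_a$ is the product of the $\upsilon_p$ over the prime factorization of $a$). For an isometry $w$ and $k\in\mathbb{Z}$, $w^{((k))}$ denotes $w^k$ if $k\ge 0$ and $(w^{*})^{-k}$ if $k<0$. $\sigma$ is the strongly continuous action of $\mathbb{R}$ on $\mathcal{T}(\mathrm{P}\rtimes\mathbb{N}^{\times})$ with $\sigma_r(s)=s$, $\sigma_r(t)=t$, $\sigma_r(\upsilon_p)=p^{ir}\upsilon_p$ for $p$ prime and $r\in\mathbb{R}$. An element $c$ is analytic for $\sigma$ if $r\mapsto\sigma_r(c)$ is the restriction to $\mathbb{R}$ of an entire function on $\mathbb{C}$, written $z\mapsto\sigma_z(c)$. For $\beta\in(0,\infty)$, a state $\phi$ is a $\mathrm{KMS}_\beta$ state for $\sigma$ if $\phi(cd)=\phi(d\,\sigma_{i\beta}(c))$ for all analytic elements $c,d$. *)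

theory Defs
  imports
    "HOL-Algebra.Module"
    "HOL-Number_Theory.Cong"
    "HOL-Analysis.Abstract_Metric_Spaces"
    "HOL-Analysis.Complex_Transcendental"
begin

section \<open>Unital C*-algebras with an explicit carrier\<close>

definition complex_ring :: "complex ring" where
  "complex_ring = \<lparr>carrier = UNIV, monoid.mult = (*), one = 1, zero = 0, add = (+)\<rparr>"

record 'a cstar_struct = "(complex, 'a) Module.module" +
  adj :: "'a \<Rightarrow> 'a" (\<open>star\<index> _\<close> [81] 80)
  nrm :: "'a \<Rightarrow> real"

text \<open>The value outside the carrier is irrelevant; it is fixed to be 0 because the locale
  \<^locale>\<open>Metric_space\<close> asks for a globally nonnegative symmetric function.\<close>

definition cdist :: "'a cstar_struct \<Rightarrow> 'a \<Rightarrow> 'a \<Rightarrow> real" where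
  "cdist A x y = (if x \<in> carrier A \<and> y \<in> carrier A then nrm A (x \<ominus>\<^bsub>A\<^esub> y) else 0)"

abbreviation ctop :: "'a cstar_struct \<Rightarrow> 'a topology" where
  "ctop A \<equiv> Metric_space.mtopology (carrier A) (cdist A)"

locale cstar_algebra = ring A + scalar: Module.module complex_ring A for A :: "'a cstar_struct" (structure) +
  assumes smult_mult_left:
      "\<lbrakk>x \<in> carrier A; y \<in> carrier A\<rbrakk> \<Longrightarrow> (c \<odot> x) \<otimes> y = c \<odot> (x \<otimes> y)"
    and smult_mult_right:
      "\<lbrakk>x \<in> carrier A; y \<in> carrier A\<rbrakk> \<Longrightarrow> x \<otimes> (c \<odot> y) = c \<odot> (x \<otimes> y)"
    and star_closed [simp, intro]: "x \<in> carrier A \<Longrightarrow> star x \<in> carrier A"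
    and star_star [simp]: "x \<in> carrier A \<Longrightarrow> star (star x) = x"
    and star_add: "\<lbrakk>x \<in> carrier A; y \<in> carrier A\<rbrakk> \<Longrightarrow> star (x \<oplus> y) = star x \<oplus> star y"
    and star_smult: "x \<in> carrier A \<Longrightarrow> star (c \<odot> x) = cnj c \<odot> star x"
    and star_mult: "\<lbrakk>x \<in> carrier A; y \<in> carrier A\<rbrakk> \<Longrightarrow> star (x \<otimes> y) = star y \<otimes> star x"
    and nrm_nonneg: "x \<in> carrier A \<Longrightarrow> 0 \<le> nrm A x"
    and nrm_eq_0_iff: "x \<in> carrier A \<Longrightarrow> nrm A x = 0 \<longleftrightarrow> x = \<zero>"
    and nrm_triangle:
      "\<lbrakk>x \<in> carrier A; y \<in> carrier A\<rbrakk> \<Longrightarrow> nrm A (x \<oplus> y) \<le> nrm A x + nrm A y"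
    and nrm_smult: "x \<in> carrier A \<Longrightarrow> nrm A (c \<odot> x) = cmod c * nrm A x"
    and nrm_mult:
      "\<lbrakk>x \<in> carrier A; y \<in> carrier A\<rbrakk> \<Longrightarrow> nrm A (x \<otimes> y) \<le> nrm A x * nrm A y"
    and nrm_star_mult: "x \<in> carrier A \<Longrightarrow> nrm A (star x \<otimes> x) = (nrm A x)\<^sup>2"
    and complete: "Metric_space.mcomplete (carrier A) (cdist A)"

definition cstar_subalgebra :: "'a cstar_struct \<Rightarrow> 'a set \<Rightarrow> bool" where
  "cstar_subalgebra A S \<longleftrightarrow>
     S \<subseteq> carrier A \<and> \<zero>\<^bsub>A\<^esub> \<in> S \<and>
     (\<forall>x\<in>S. \<forall>y\<in>S. x \<oplus>\<^bsub>A\<^esub> y \<in> S) \<and>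
     (\<forall>x\<in>S. \<forall>y\<in>S. x \<otimes>\<^bsub>A\<^esub> y \<in> S) \<and>
     (\<forall>c. \<forall>x\<in>S. c \<odot>\<^bsub>A\<^esub> x \<in> S) \<and>
     (\<forall>x\<in>S. star\<^bsub>A\<^esub> x \<in> S) \<and>
     closedin (ctop A) S"

definition cstar_gen :: "'a cstar_struct \<Rightarrow> 'a set \<Rightarrow> 'a set" where
  "cstar_gen A G = \<Inter> {S. cstar_subalgebra A S \<and> G \<subseteq> S}"

definition star_hom :: "'a cstar_struct \<Rightarrow> 'b cstar_struct \<Rightarrow> ('a \<Rightarrow> 'b) \<Rightarrow> bool" where
  "star_hom A B h \<longleftrightarrow>
     h \<in> carrier A \<rightarrow> carrier B \<and>
     (\<forall>x\<in>carrier A. \<forall>y\<in>carrier A. h (x \<oplus>\<^bsub>A\<^esub> y) = h x \<oplus>\<^bsub>B\<^esub> h y) \<and>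
     (\<forall>x\<in>carrier A. \<forall>y\<in>carrier A. h (x \<otimes>\<^bsub>A\<^esub> y) = h x \<otimes>\<^bsub>B\<^esub> h y) \<and>
     (\<forall>c. \<forall>x\<in>carrier A. h (c \<odot>\<^bsub>A\<^esub> x) = c \<odot>\<^bsub>B\<^esub> h x) \<and>
     (\<forall>x\<in>carrier A. h (star\<^bsub>A\<^esub> x) = star\<^bsub>B\<^esub> (h x))"


section \<open>The semigroup and its covariant isometric representations\<close>

definition P :: "nat set" where
  "P = {m. m \<noteq> 1}"

definition PN :: "(nat \<times> nat) monoid" where
  "PN = \<lparr>carrier = P \<times> {a. a > 0},
         monoid.mult = (\<lambda>(m, a) (n, b). (m + a * n, a * b)),
         one = (0, 1)\<rparr>"

text \<open>\<^term>\<open>None\<close> plays the role of \<open>\<infinity>\<close>.\<close>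

definition cup :: "nat \<times> nat \<Rightarrow> nat \<times> nat \<Rightarrow> (nat \<times> nat) option" where
  "cup = (\<lambda>(m, a) (n, b).
     let I = (\<lambda>k. m + a * k) ` P \<inter> (\<lambda>k. n + b * k) ` P
     in if I = {} then None else Some (LEAST l. l \<in> I, lcm a b))"

definition isometric_rep :: "'a cstar_struct \<Rightarrow> (nat \<times> nat \<Rightarrow> 'a) \<Rightarrow> bool" where
  "isometric_rep A W \<longleftrightarrow>
     W \<in> carrier PN \<rightarrow> carrier A \<and>
     (\<forall>x\<in>carrier PN. star\<^bsub>A\<^esub> (W x) \<otimes>\<^bsub>A\<^esub> W x = \<one>\<^bsub>A\<^esub>) \<and>
     W \<one>\<^bsub>PN\<^esub> = \<one>\<^bsub>A\<^esub> \<and>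
     (\<forall>x\<in>carrier PN. \<forall>y\<in>carrier PN. W (x \<otimes>\<^bsub>PN\<^esub> y) = W x \<otimes>\<^bsub>A\<^esub> W y)"

definition covariant_rep :: "'a cstar_struct \<Rightarrow> (nat \<times> nat \<Rightarrow> 'a) \<Rightarrow> bool" where
  "covariant_rep A W \<longleftrightarrow>
     isometric_rep A W \<and>
     (\<forall>x\<in>carrier PN. \<forall>y\<in>carrier PN.
        W x \<otimes>\<^bsub>A\<^esub> star\<^bsub>A\<^esub> (W x) \<otimes>\<^bsub>A\<^esub> W y \<otimes>\<^bsub>A\<^esub> star\<^bsub>A\<^esub> (W y) =
        (case cup x y of None \<Rightarrow> \<zero>\<^bsub>A\<^esub> | Some z \<Rightarrow> W z \<otimes>\<^bsub>A\<^esub> star\<^bsub>A\<^esub> (W z)))"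

text \<open>The pair \<open>(A, W)\<close> is a model of the Toeplitz algebra with its canonical representation.
  HOL cannot quantify over all types inside a formula, so the representations in the universal
  property live in C*-algebras carried by subsets of \<^typ>\<open>real\<close>. Nothing is lost: the
  C*-algebra generated by a representation of the countable semigroup is separable, hence has at
  most continuum many elements. The resulting universal property for C*-algebras over
  arbitrary types is the lemma \<open>universal_covariant_rep_any\<close> below.\<close>

definition universal_covariant_rep :: "'a cstar_struct \<Rightarrow> (nat \<times> nat \<Rightarrow> 'a) \<Rightarrow> bool" where
  "universal_covariant_rep A W \<longleftrightarrow>
     cstar_algebra A \<and> covariant_rep A W \<and>
     carrier A = cstar_gen A (W ` carrier PN) \<and>
     (\<forall>(B :: real cstar_struct) X. cstar_algebra B \<and> covariant_rep B X \<longrightarrow>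
        (\<exists>h. star_hom A B h \<and> h ` carrier A \<subseteq> cstar_gen B (X ` carrier PN) \<and>
             (\<forall>x\<in>carrier PN. h (W x) = X x)))"


section \<open>The dynamics and KMS states\<close>

definition strongly_continuous_action :: "'a cstar_struct \<Rightarrow> (real \<Rightarrow> 'a \<Rightarrow> 'a) \<Rightarrow> bool" where
  "strongly_continuous_action A \<sigma> \<longleftrightarrow>
     (\<forall>r. star_hom A A (\<sigma> r) \<and> bij_betw (\<sigma> r) (carrier A) (carrier A)) \<and>
     (\<forall>c\<in>carrier A. \<sigma> 0 c = c) \<and>
     (\<forall>r r'. \<forall>c\<in>carrier A. \<sigma> (r + r') c = \<sigma> r (\<sigma> r' c)) \<and>
     (\<forall>c\<in>carrier A. continuous_map euclideanreal (ctop A) (\<lambda>r. \<sigma> r c))"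

definition canonical_dynamics ::
    "'a cstar_struct \<Rightarrow> (nat \<times> nat \<Rightarrow> 'a) \<Rightarrow> (real \<Rightarrow> 'a \<Rightarrow> 'a) \<Rightarrow> bool" where
  "canonical_dynamics A W \<sigma> \<longleftrightarrow>
     strongly_continuous_action A \<sigma> \<and>
     (\<forall>r. \<sigma> r (W (2, 1)) = W (2, 1)) \<and>
     (\<forall>r. \<sigma> r (W (3, 1)) = W (3, 1)) \<and>
     (\<forall>r p. prime p \<longrightarrow>
        \<sigma> r (W (0, p)) = (of_nat p powr (\<i> * of_real r)) \<odot>\<^bsub>A\<^esub> W (0, p))"

definition entire_map :: "'a cstar_struct \<Rightarrow> (complex \<Rightarrow> 'a) \<Rightarrow> bool" where
  "entire_map A F \<longleftrightarrow>
     range F \<subseteq> carrier A \<and>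
     (\<forall>z. \<exists>D. limitin (ctop A)
        (\<lambda>h. (1 / h) \<odot>\<^bsub>A\<^esub> (F (z + h) \<ominus>\<^bsub>A\<^esub> F z)) D (at 0))"

text \<open>\<^term>\<open>F\<close> is the (unique) entire extension, written \<open>z \<mapsto> \<sigma>\<^sub>z(c)\<close> informally.\<close>

definition entire_extension ::
    "'a cstar_struct \<Rightarrow> (real \<Rightarrow> 'a \<Rightarrow> 'a) \<Rightarrow> 'a \<Rightarrow> (complex \<Rightarrow> 'a) \<Rightarrow> bool" where
  "entire_extension A \<sigma> c F \<longleftrightarrow> entire_map A F \<and> (\<forall>r. F (of_real r) = \<sigma> r c)"

definition analytic_element :: "'a cstar_struct \<Rightarrow> (real \<Rightarrow> 'a \<Rightarrow> 'a) \<Rightarrow> 'a \<Rightarrow> bool" where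
  "analytic_element A \<sigma> c \<longleftrightarrow> c \<in> carrier A \<and> (\<exists>F. entire_extension A \<sigma> c F)"

definition cstar_state :: "'a cstar_struct \<Rightarrow> ('a \<Rightarrow> complex) \<Rightarrow> bool" where
  "cstar_state A \<phi> \<longleftrightarrow>
     (\<forall>x\<in>carrier A. \<forall>y\<in>carrier A. \<phi> (x \<oplus>\<^bsub>A\<^esub> y) = \<phi> x + \<phi> y) \<and>
     (\<forall>c. \<forall>x\<in>carrier A. \<phi> (c \<odot>\<^bsub>A\<^esub> x) = c * \<phi> x) \<and>
     (\<forall>x\<in>carrier A. \<phi> (star\<^bsub>A\<^esub> x \<otimes>\<^bsub>A\<^esub> x) \<in> \<real>\<^sub>\<ge>\<^sub>0) \<and>
     \<phi> \<one>\<^bsub>A\<^esub> = 1"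

definition KMS_state ::
    "'a cstar_struct \<Rightarrow> (real \<Rightarrow> 'a \<Rightarrow> 'a) \<Rightarrow> real \<Rightarrow> ('a \<Rightarrow> complex) \<Rightarrow> bool" where
  "KMS_state A \<sigma> \<beta> \<phi> \<longleftrightarrow>
     cstar_state A \<phi> \<and>
     (\<forall>c d F. analytic_element A \<sigma> c \<and> analytic_element A \<sigma> d \<and> entire_extension A \<sigma> c F \<longrightarrow>
        \<phi> (c \<otimes>\<^bsub>A\<^esub> d) = \<phi> (d \<otimes>\<^bsub>A\<^esub> F (\<i> * of_real \<beta>)))"

definition ipow :: "'a cstar_struct \<Rightarrow> 'a \<Rightarrow> int \<Rightarrow> 'a" where
  "ipow A w k = (if 0 \<le> k then w [^]\<^bsub>A\<^esub> nat k else (star\<^bsub>A\<^esub> w) [^]\<^bsub>A\<^esub> nat (- k))"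

section \<open>The universal property over arbitrary types\<close>

context cstar_algebra
begin

lemma minus_eq_smult: "x \<in> carrier A \<Longrightarrow> \<ominus> x = (- 1) \<odot> x"
proof -
  assume x: "x \<in> carrier A"
  have z: "(0::complex) \<odot> x = \<zero>"
    using scalar.smult_l_null[OF x] by (simp add: complex_ring_def)
  have "((-1) + 1 :: complex) \<odot> x = (-1) \<odot> x \<oplus> 1 \<odot> x"
    using scalar.smult_l_distr[of "-1" 1 x] x by (simp add: complex_ring_def)
  moreover have "(1::complex) \<odot> x = x"
    using scalar.smult_one[OF x] by (simp add: complex_ring_def)
  ultimately have "(-1) \<odot> x \<oplus> x = \<zero>" using z by simp
  moreover have "(-1) \<odot> x \<in> carrier A"
    using scalar.smult_closed[of "-1" x] x by (simp add: complex_ring_def)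
  ultimately show ?thesis using x minus_equality[of "(-1) \<odot> x" x] by blast
qed

lemma smult_cl [simp, intro]: "x \<in> carrier A \<Longrightarrow> c \<odot> x \<in> carrier A"
  using scalar.smult_closed[of c x] by (simp add: complex_ring_def)

lemma nrm_uminus: "x \<in> carrier A \<Longrightarrow> nrm A (\<ominus> x) = nrm A x"
  by (simp add: minus_eq_smult nrm_smult)

lemma nrm_minus_commute:
  "x \<in> carrier A \<Longrightarrow> y \<in> carrier A \<Longrightarrow> nrm A (x \<ominus> y) = nrm A (y \<ominus> x)"
proof -
  assume x: "x \<in> carrier A" "y \<in> carrier A"
  have "\<ominus> (x \<ominus> y) = y \<ominus> x" using x minus_add[of x "\<ominus> y"] by (simp add: a_minus_def a_comm)
  then show ?thesis using nrm_uminus[of "x \<ominus> y"] x by simp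
qed

lemma minus_eq_zero_iff:
  "x \<in> carrier A \<Longrightarrow> y \<in> carrier A \<Longrightarrow> x \<ominus> y = \<zero> \<longleftrightarrow> x = y"
proof -
  assume xy: "x \<in> carrier A" "y \<in> carrier A"
  have "x \<ominus> y \<oplus> y = x" using xy by (simp add: a_minus_def a_assoc l_neg)
  then show ?thesis using xy by (auto simp: a_minus_def r_neg)
qed

lemma Metric_space_cdist: "Metric_space (carrier A) (cdist A)"
proof
  show "0 \<le> cdist A x y" for x y by (simp add: cdist_def nrm_nonneg)
  show "cdist A x y = cdist A y x" for x y by (simp add: cdist_def nrm_minus_commute)
  show "(cdist A x y = 0) = (x = y)" if "x \<in> carrier A" "y \<in> carrier A" for x y
    using that by (simp add: cdist_def nrm_eq_0_iff minus_eq_zero_iff)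
  show "cdist A x z \<le> cdist A x y + cdist A y z"
    if "x \<in> carrier A" "y \<in> carrier A" "z \<in> carrier A" for x y z
  proof -
    have "x \<ominus> z = (x \<ominus> y) \<oplus> (y \<ominus> z)"
      using that by (simp add: a_minus_def a_assoc[symmetric]) (simp add: a_assoc l_neg)
    then show ?thesis using that nrm_triangle[of "x \<ominus> y" "y \<ominus> z"] by (simp add: cdist_def)
  qed
qed

lemma cstar_subalgebra_carrier: "cstar_subalgebra A (carrier A)"
proof -
  interpret Metric_space "carrier A" "cdist A" by (rule Metric_space_cdist)
  show ?thesis unfolding cstar_subalgebra_def using closedin_topspace[of mtopology] by auto
qed

lemma cstar_subalgebra_gen: "G \<subseteq> carrier A \<Longrightarrow> cstar_subalgebra A (cstar_gen A G)"
proof -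
  assume G: "G \<subseteq> carrier A"
  let ?F = "{S. cstar_subalgebra A S \<and> G \<subseteq> S}"
  have ne: "?F \<noteq> {}" using cstar_subalgebra_carrier G by blast
  have "closedin (ctop A) (\<Inter> ?F)"
    by (rule closedin_Inter) (use ne in \<open>auto simp: cstar_subalgebra_def\<close>)
  then show ?thesis
    unfolding cstar_gen_def cstar_subalgebra_def[of A "\<Inter> ?F"]
    using cstar_subalgebra_carrier G by (auto simp: cstar_subalgebra_def)
qed

lemma limitin_ctop_iff:
  assumes "range f \<subseteq> carrier A"
  shows "limitin (ctop A) f x sequentially \<longleftrightarrow>
     x \<in> carrier A \<and> ((\<lambda>n. nrm A (f n \<ominus> x)) \<longlongrightarrow> 0) sequentially"
proof -
  interpret Metric_space "carrier A" "cdist A" by (rule Metric_space_cdist)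
  have "x \<in> carrier A \<Longrightarrow> (\<lambda>n. cdist A (f n) x) = (\<lambda>n. nrm A (f n \<ominus> x))"
    using assms by (auto simp: cdist_def fun_eq_iff image_subset_iff)
  then show ?thesis
    using assms by (auto simp: limitin_metric_dist_null range_subsetD)
qed

lemma nrm_zero: "nrm A \<zero> = 0" by (simp add: nrm_eq_0_iff)

lemma nrm_star_le: "x \<in> carrier A \<Longrightarrow> nrm A x \<le> nrm A (star x)"
proof -
  assume x: "x \<in> carrier A"
  have "(nrm A x)\<^sup>2 \<le> nrm A (star x) * nrm A x"
    using nrm_star_mult[OF x] nrm_mult[of "star x" x] x by simp
  then show ?thesis using nrm_nonneg[OF x] nrm_nonneg[OF star_closed[OF x]]
    by (cases "nrm A x = 0") (auto simp: power2_eq_square)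
qed

lemma nrm_star: "x \<in> carrier A \<Longrightarrow> nrm A (star x) = nrm A x"
  using nrm_star_le[of x] nrm_star_le[of "star x"] by simp

end

definition cstar_transport :: "'a cstar_struct \<Rightarrow> 'a set \<Rightarrow> ('a \<Rightarrow> 'b) \<Rightarrow> 'b cstar_struct" where
  "cstar_transport B C g = (let h = inv_into C g in
    \<lparr>carrier = g ` C, monoid.mult = (\<lambda>x y. g (h x \<otimes>\<^bsub>B\<^esub> h y)), one = g \<one>\<^bsub>B\<^esub>,
     zero = g \<zero>\<^bsub>B\<^esub>, add = (\<lambda>x y. g (h x \<oplus>\<^bsub>B\<^esub> h y)),
     smult = (\<lambda>c x. g (c \<odot>\<^bsub>B\<^esub> h x)), adj = (\<lambda>x. g (star\<^bsub>B\<^esub> (h x))),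
     nrm = (\<lambda>x. nrm B (h x))\<rparr>)"

lemma cstar_transport_ops:
  assumes "inj_on g C"
  shows "carrier (cstar_transport B C g) = g ` C"
    "\<one>\<^bsub>cstar_transport B C g\<^esub> = g \<one>\<^bsub>B\<^esub>" "\<zero>\<^bsub>cstar_transport B C g\<^esub> = g \<zero>\<^bsub>B\<^esub>"
    "\<And>x y. x \<in> C \<Longrightarrow> y \<in> C \<Longrightarrow> g x \<otimes>\<^bsub>cstar_transport B C g\<^esub> g y = g (x \<otimes>\<^bsub>B\<^esub> y)"
    "\<And>x y. x \<in> C \<Longrightarrow> y \<in> C \<Longrightarrow> g x \<oplus>\<^bsub>cstar_transport B C g\<^esub> g y = g (x \<oplus>\<^bsub>B\<^esub> y)"
    "\<And>c x. x \<in> C \<Longrightarrow> c \<odot>\<^bsub>cstar_transport B C g\<^esub> g x = g (c \<odot>\<^bsub>B\<^esub> x)"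
    "\<And>x. x \<in> C \<Longrightarrow> star\<^bsub>cstar_transport B C g\<^esub> (g x) = g (star\<^bsub>B\<^esub> x)"
    "\<And>x. x \<in> C \<Longrightarrow> nrm (cstar_transport B C g) (g x) = nrm B x"
  using assms by (auto simp: cstar_transport_def Let_def inv_into_f_f)

lemma cring_complex_ring: "cring complex_ring"
proof (rule cringI)
  show "abelian_group complex_ring"
  proof (rule abelian_groupI)
    show "\<exists>y\<in>carrier complex_ring. y \<oplus>\<^bsub>complex_ring\<^esub> x = \<zero>\<^bsub>complex_ring\<^esub>" for x
      by (rule bexI[of _ "- x"]) (simp_all add: complex_ring_def)
  qed (simp_all add: complex_ring_def)
  show "comm_monoid complex_ring"
    by (rule comm_monoidI) (simp_all add: complex_ring_def)
qed (simp add: complex_ring_def distrib_right)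

lemma cstar_algebra_transport:
  assumes B: "cstar_algebra B" and C: "cstar_subalgebra B C" and one: "\<one>\<^bsub>B\<^esub> \<in> C"
    and g: "inj_on g C"
  shows "cstar_algebra (cstar_transport B C g)"
proof -
  interpret B: cstar_algebra B by (rule B)
  let ?T = "cstar_transport B C g"
  note ops = cstar_transport_ops[OF g, where B = B]
  have CB: "x \<in> C \<Longrightarrow> x \<in> carrier B" for x using C by (auto simp: cstar_subalgebra_def)
  have cl: "\<zero>\<^bsub>B\<^esub> \<in> C" "\<And>x y. x \<in> C \<Longrightarrow> y \<in> C \<Longrightarrow> x \<oplus>\<^bsub>B\<^esub> y \<in> C"
    "\<And>x y. x \<in> C \<Longrightarrow> y \<in> C \<Longrightarrow> x \<otimes>\<^bsub>B\<^esub> y \<in> C"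
    "\<And>c x. x \<in> C \<Longrightarrow> c \<odot>\<^bsub>B\<^esub> x \<in> C" "\<And>x. x \<in> C \<Longrightarrow> star\<^bsub>B\<^esub> x \<in> C"
    using C by (auto simp: cstar_subalgebra_def)
  have uminus_C: "x \<in> C \<Longrightarrow> \<ominus>\<^bsub>B\<^esub> x \<in> C" for x
    by (simp add: B.minus_eq_smult CB cl)
  have ag: "abelian_group ?T"
  proof (rule abelian_groupI)
    show "\<exists>y\<in>carrier ?T. y \<oplus>\<^bsub>?T\<^esub> x = \<zero>\<^bsub>?T\<^esub>" if "x \<in> carrier ?T" for x
    proof -
      obtain x' where x': "x = g x'" "x' \<in> C" using \<open>x \<in> carrier ?T\<close> by (auto simp: ops)
      then have "g (\<ominus>\<^bsub>B\<^esub> x') \<oplus>\<^bsub>?T\<^esub> x = \<zero>\<^bsub>?T\<^esub>"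
        by (simp add: ops uminus_C CB B.l_neg)
      then show ?thesis using x' by (auto simp: ops uminus_C)
    qed
  qed (auto simp: ops cl CB B.a_assoc intro!: arg_cong[of _ _ g] B.a_comm)
  have ri: "ring ?T"
  proof (rule ringI[OF ag])
    show "monoid ?T"
      by (rule monoidI) (auto simp: ops cl one CB B.m_assoc)
  qed (auto simp: ops cl one CB B.l_distr B.r_distr)
  interpret T: ring ?T by (rule ri)
  have mo: "Module.module complex_ring ?T"
  proof (rule moduleI[OF cring_complex_ring ag])
    show "(a \<oplus>\<^bsub>complex_ring\<^esub> b) \<odot>\<^bsub>?T\<^esub> x = a \<odot>\<^bsub>?T\<^esub> x \<oplus>\<^bsub>?T\<^esub> b \<odot>\<^bsub>?T\<^esub> x"
      if "a \<in> carrier complex_ring" "b \<in> carrier complex_ring" "x \<in> carrier ?T" for a b x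
      using that by (auto simp: ops cl CB B.scalar.smult_l_distr)
    show "(a \<otimes>\<^bsub>complex_ring\<^esub> b) \<odot>\<^bsub>?T\<^esub> x = a \<odot>\<^bsub>?T\<^esub> (b \<odot>\<^bsub>?T\<^esub> x)"
      if "a \<in> carrier complex_ring" "b \<in> carrier complex_ring" "x \<in> carrier ?T" for a b x
      using that by (auto simp: ops cl CB B.scalar.smult_assoc1)
  qed (auto simp: ops cl CB B.scalar.smult_r_distr)
  have diff: "g x \<ominus>\<^bsub>?T\<^esub> g y = g (x \<ominus>\<^bsub>B\<^esub> y)" if "x \<in> C" "y \<in> C" for x y
  proof -
    have "g (\<ominus>\<^bsub>B\<^esub> y) \<oplus>\<^bsub>?T\<^esub> g y = \<zero>\<^bsub>?T\<^esub>"
      using that by (simp add: ops uminus_C CB B.l_neg)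
    then have "\<ominus>\<^bsub>?T\<^esub> g y = g (\<ominus>\<^bsub>B\<^esub> y)"
      using that by (intro T.minus_equality) (auto simp: ops uminus_C)
    then show ?thesis using that by (simp add: a_minus_def ops uminus_C)
  qed
  have minus_C: "x \<ominus>\<^bsub>B\<^esub> y \<in> C" if "x \<in> C" "y \<in> C" for x y
    using that by (simp add: a_minus_def uminus_C cl)
  have dist: "cdist ?T (g x) (g y) = cdist B x y" if "x \<in> C" "y \<in> C" for x y
    using that by (simp add: cdist_def ops diff CB minus_C)
  have nonneg: "0 \<le> nrm ?T x" if "x \<in> carrier ?T" for x
    using that by (auto simp: ops CB B.nrm_nonneg)
  have zero: "(nrm ?T x = 0) = (x = \<zero>\<^bsub>?T\<^esub>)" if "x \<in> carrier ?T" for x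
    using that inj_on_eq_iff[OF g _ cl(1)] by (auto simp: ops CB B.nrm_eq_0_iff)
  interpret MB: Metric_space "carrier B" "cdist B" by (rule B.Metric_space_cdist)
  interpret MC: Submetric "carrier B" "cdist B" C
    by unfold_locales (use CB in auto)
  interpret MT: Metric_space "carrier ?T" "cdist ?T"
  proof
    show "0 \<le> cdist ?T x y" for x y
      using nonneg by (simp add: cdist_def)
    have sym: "cdist ?T x y = cdist ?T y x" if "x \<in> carrier ?T" "y \<in> carrier ?T" for x y
      using that by (auto simp: ops dist MB.commute)
    then show "cdist ?T x y = cdist ?T y x" for x y
      by (cases "x \<in> carrier ?T \<and> y \<in> carrier ?T") (auto simp: cdist_def)
    show "(cdist ?T x y = 0) = (x = y)" if "x \<in> carrier ?T" "y \<in> carrier ?T" for x y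
      using that g by (auto simp: ops dist CB inj_on_eq_iff)
    show "cdist ?T x z \<le> cdist ?T x y + cdist ?T y z"
      if "x \<in> carrier ?T" "y \<in> carrier ?T" "z \<in> carrier ?T" for x y z
      using that by (auto simp: ops dist CB MB.triangle)
  qed
  have "MC.sub.mcomplete"
    using MC.closedin_mcomplete_imp_mcomplete B.complete C by (auto simp: cstar_subalgebra_def)
  have compl: "MT.mcomplete"
    unfolding MT.mcomplete_def
  proof (intro allI impI)
    fix f assume f: "MT.MCauchy f"
    define h where "h = inv_into C g"
    have fr: "f n \<in> g ` C" for n
      using f unfolding MT.MCauchy_def by (simp add: ops image_subset_iff)
    have h: "h (f n) \<in> C" "g (h (f n)) = f n" for n
      using fr[of n] by (simp_all add: h_def inv_into_into f_inv_into_f)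
    have d: "cdist ?T (f n) (f k) = cdist B (h (f n)) (h (f k))" for n k
      using dist[OF h(1)[of n] h(1)[of k]] by (simp add: h)
    have "MC.sub.MCauchy (\<lambda>n. h (f n))"
      using f h(1) unfolding MT.MCauchy_def MC.sub.MCauchy_def d by auto
    then obtain x where x: "limitin MC.sub.mtopology (\<lambda>n. h (f n)) x sequentially"
      using \<open>MC.sub.mcomplete\<close> by (auto simp: MC.sub.mcomplete_def)
    then have xC: "x \<in> C" by (auto simp: MC.sub.limitin_metric)
    have dx: "cdist ?T (f n) (g x) = cdist B (h (f n)) x" for n
      using dist[OF h(1)[of n] xC] by (simp add: h)
    have "\<forall>\<epsilon>>0. \<forall>\<^sub>F n in sequentially. h (f n) \<in> C \<and> cdist B (h (f n)) x < \<epsilon>"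
      using x unfolding MC.sub.limitin_metric by blast
    then have "\<forall>\<epsilon>>0. \<forall>\<^sub>F n in sequentially. f n \<in> carrier ?T \<and> cdist ?T (f n) (g x) < \<epsilon>"
      unfolding dx using fr by (simp add: h(1) ops(1))
    then have "limitin MT.mtopology f (g x) sequentially"
      unfolding MT.limitin_metric using xC by (simp add: ops(1))
    then show "\<exists>x. limitin MT.mtopology f x sequentially" ..
  qed
  show ?thesis
    by (intro cstar_algebra.intro ri mo cstar_algebra_axioms.intro nonneg zero compl)
       (auto simp: ops cl CB B.smult_mult_left B.smult_mult_right B.star_add B.star_smult
          B.star_mult B.nrm_triangle B.nrm_smult B.nrm_mult B.nrm_star_mult)
qed


fun gen_stage :: "'a cstar_struct \<Rightarrow> 'a set \<Rightarrow> nat \<Rightarrow> 'a set" where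
  "gen_stage A G 0 = insert \<zero>\<^bsub>A\<^esub> G"
| "gen_stage A G (Suc n) = gen_stage A G n
     \<union> (\<lambda>(x, y). x \<oplus>\<^bsub>A\<^esub> y) ` (gen_stage A G n \<times> gen_stage A G n)
     \<union> (\<lambda>(x, y). x \<otimes>\<^bsub>A\<^esub> y) ` (gen_stage A G n \<times> gen_stage A G n)
     \<union> (\<lambda>((p, q), x). Complex (of_rat p) (of_rat q) \<odot>\<^bsub>A\<^esub> x) ` (UNIV \<times> gen_stage A G n)
     \<union> (\<lambda>x. star\<^bsub>A\<^esub> x) ` gen_stage A G n"

definition gen_dense :: "'a cstar_struct \<Rightarrow> 'a set \<Rightarrow> 'a set" where
  "gen_dense A G = (\<Union>n. gen_stage A G n)"

lemma gen_stage_mono: "n \<le> k \<Longrightarrow> gen_stage A G n \<subseteq> gen_stage A G k"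
  by (rule lift_Suc_mono_le) auto

lemma countable_gen_dense:
  assumes "countable G" shows "countable (gen_dense A G)"
proof -
  have "countable (gen_stage A G n)" for n
    by (induction n) (auto simp: assms)
  then show ?thesis by (simp add: gen_dense_def)
qed

lemma gen_dense_common:
  assumes "x \<in> gen_dense A G" "y \<in> gen_dense A G"
  obtains n where "x \<in> gen_stage A G n" "y \<in> gen_stage A G n"
proof -
  obtain i j where "x \<in> gen_stage A G i" "y \<in> gen_stage A G j"
    using assms by (auto simp: gen_dense_def)
  then have "x \<in> gen_stage A G (max i j)" "y \<in> gen_stage A G (max i j)"
    using gen_stage_mono[of i "max i j" A G] gen_stage_mono[of j "max i j" A G] by auto
  then show thesis by (rule that)
qed

lemma gen_dense_closed:
  shows "\<zero>\<^bsub>A\<^esub> \<in> gen_dense A G" "G \<subseteq> gen_dense A G"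
    "\<And>x y. x \<in> gen_dense A G \<Longrightarrow> y \<in> gen_dense A G \<Longrightarrow> x \<oplus>\<^bsub>A\<^esub> y \<in> gen_dense A G"
    "\<And>x y. x \<in> gen_dense A G \<Longrightarrow> y \<in> gen_dense A G \<Longrightarrow> x \<otimes>\<^bsub>A\<^esub> y \<in> gen_dense A G"
    "\<And>p q x. x \<in> gen_dense A G \<Longrightarrow> Complex (of_rat p) (of_rat q) \<odot>\<^bsub>A\<^esub> x \<in> gen_dense A G"
    "\<And>x. x \<in> gen_dense A G \<Longrightarrow> star\<^bsub>A\<^esub> x \<in> gen_dense A G"
proof -
  have 0: "gen_stage A G 0 \<subseteq> gen_dense A G" unfolding gen_dense_def by blast
  have S: "gen_stage A G (Suc n) \<subseteq> gen_dense A G" for n unfolding gen_dense_def by blast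
  show "\<zero>\<^bsub>A\<^esub> \<in> gen_dense A G" "G \<subseteq> gen_dense A G" using 0 by auto
  show "x \<oplus>\<^bsub>A\<^esub> y \<in> gen_dense A G" if "x \<in> gen_dense A G" "y \<in> gen_dense A G" for x y
  proof -
    obtain n where n: "x \<in> gen_stage A G n" "y \<in> gen_stage A G n"
      using gen_dense_common[OF \<open>x \<in> gen_dense A G\<close> \<open>y \<in> gen_dense A G\<close>] by blast
    have "x \<oplus>\<^bsub>A\<^esub> y \<in> gen_stage A G (Suc n)"
      unfolding gen_stage.simps by (rule UnI1, rule UnI1, rule UnI1, rule UnI2, rule image_eqI[where x = "(x, y)"], simp_all add: n)
    then show ?thesis using S by blast
  qed
  show "x \<otimes>\<^bsub>A\<^esub> y \<in> gen_dense A G" if "x \<in> gen_dense A G" "y \<in> gen_dense A G" for x y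
  proof -
    obtain n where n: "x \<in> gen_stage A G n" "y \<in> gen_stage A G n"
      using gen_dense_common[OF \<open>x \<in> gen_dense A G\<close> \<open>y \<in> gen_dense A G\<close>] by blast
    have "x \<otimes>\<^bsub>A\<^esub> y \<in> gen_stage A G (Suc n)"
      unfolding gen_stage.simps by (rule UnI1, rule UnI1, rule UnI2, rule image_eqI[where x = "(x, y)"], simp_all add: n)
    then show ?thesis using S by blast
  qed
  show "Complex (of_rat p) (of_rat q) \<odot>\<^bsub>A\<^esub> x \<in> gen_dense A G" if "x \<in> gen_dense A G" for p q x
  proof -
    obtain n where n: "x \<in> gen_stage A G n"
      using \<open>x \<in> gen_dense A G\<close> by (auto simp: gen_dense_def)
    have "Complex (of_rat p) (of_rat q) \<odot>\<^bsub>A\<^esub> x \<in> gen_stage A G (Suc n)"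
      unfolding gen_stage.simps by (rule UnI1, rule UnI2, rule image_eqI[where x = "((p, q), x)"], simp_all add: n)
    then show ?thesis using S by blast
  qed
  show "star\<^bsub>A\<^esub> x \<in> gen_dense A G" if "x \<in> gen_dense A G" for x
  proof -
    obtain n where n: "x \<in> gen_stage A G n"
      using \<open>x \<in> gen_dense A G\<close> by (auto simp: gen_dense_def)
    have "star\<^bsub>A\<^esub> x \<in> gen_stage A G (Suc n)"
      unfolding gen_stage.simps by (rule UnI2, rule image_eqI[where x = x], simp_all add: n)
    then show ?thesis using S by blast
  qed
qed

lemma rat_complex_seq:
  obtains p q :: "nat \<Rightarrow> rat" where "(\<lambda>n. Complex (of_rat (p n)) (of_rat (q n))) \<longlonglongrightarrow> c"
proof -
  have *: "\<exists>p :: nat \<Rightarrow> rat. (\<lambda>n. of_rat (p n) :: real) \<longlonglongrightarrow> r" for r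
  proof -
    have "\<exists>p. r < of_rat p \<and> of_rat p < r + inverse (real (Suc n))" for n
      using of_rat_dense[of r "r + inverse (real (Suc n))"] by simp
    then obtain p where p: "\<And>n. r < of_rat (p n)" "\<And>n. of_rat (p n) < r + inverse (real (Suc n))"
      by metis
    have "(\<lambda>n. of_rat (p n) :: real) \<longlonglongrightarrow> r"
    proof (rule tendsto_sandwich[OF _ _ tendsto_const])
      show "(\<lambda>n. r + inverse (real (Suc n))) \<longlonglongrightarrow> r"
        using LIMSEQ_inverse_real_of_nat_add[of r] by simp
    qed (use p in \<open>auto intro!: always_eventually less_imp_le\<close>)
    then show ?thesis by blast
  qed
  obtain p q where "(\<lambda>n. of_rat (p n) :: real) \<longlonglongrightarrow> Re c" "(\<lambda>n. of_rat (q n) :: real) \<longlonglongrightarrow> Im c"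
    using * by metis
  then have "(\<lambda>n. Complex (of_rat (p n)) (of_rat (q n))) \<longlonglongrightarrow> Complex (Re c) (Im c)"
    by (rule tendsto_Complex)
  then show thesis using that by simp
qed

context cstar_algebra
begin

lemma gen_dense_carrier: "G \<subseteq> carrier A \<Longrightarrow> gen_dense A G \<subseteq> carrier A"
proof -
  assume G: "G \<subseteq> carrier A"
  have "gen_stage A G n \<subseteq> carrier A" for n
    by (induction n) (use G in auto)
  then show ?thesis by (auto simp: gen_dense_def)
qed

lemma minus_add_distrib4:
  "\<lbrakk>a \<in> carrier A; b \<in> carrier A; c \<in> carrier A; d \<in> carrier A\<rbrakk> \<Longrightarrow>
     (a \<oplus> b) \<ominus> (c \<oplus> d) = (a \<ominus> c) \<oplus> (b \<ominus> d)"
  by (simp add: a_minus_def minus_add a_ac)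

text \<open>A countable set generates a separable algebra, which therefore embeds into \<^typ>\<open>real\<close> as a set.\<close>

lemma cstar_subalgebra_closure:
  assumes G: "G \<subseteq> carrier A"
  shows "cstar_subalgebra A (ctop A closure_of gen_dense A G)"
proof -
  interpret M: Metric_space "carrier A" "cdist A" by (rule Metric_space_cdist)
  let ?D = "gen_dense A G"
  let ?E = "ctop A closure_of ?D"
  have D: "?D \<subseteq> carrier A" by (rule gen_dense_carrier[OF G])
  have E_iff: "x \<in> ?E \<longleftrightarrow> x \<in> carrier A \<and>
      (\<exists>f. range f \<subseteq> ?D \<and> (\<lambda>n. nrm A (f n \<ominus> x)) \<longlonglongrightarrow> 0)" for x
  proof -
    have "x \<in> ?E \<longleftrightarrow> (\<exists>f. range f \<subseteq> ?D \<inter> carrier A \<and> limitin (ctop A) f x sequentially)"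
      by (auto simp: M.closure_of_sequentially dest: M.limitin_mspace)
    also have "\<dots> \<longleftrightarrow> (\<exists>f. range f \<subseteq> ?D \<and> limitin (ctop A) f x sequentially)"
      using D by (simp add: Int_absorb2)
    also have "\<dots> \<longleftrightarrow> x \<in> carrier A \<and> (\<exists>f. range f \<subseteq> ?D \<and> (\<lambda>n. nrm A (f n \<ominus> x)) \<longlonglongrightarrow> 0)"
      using D limitin_ctop_iff by (meson order_trans)
    finally show ?thesis .
  qed
  have EI: "x \<in> ?E" if "x \<in> carrier A" "\<And>n. f n \<in> ?D" "\<And>n. nrm A (f n \<ominus> x) \<le> e n" "e \<longlonglongrightarrow> 0"
    for x f and e :: "nat \<Rightarrow> real"
  proof -
    have fc: "f n \<in> carrier A" for n using that(2) D by blast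
    have "(\<lambda>n. nrm A (f n \<ominus> x)) \<longlonglongrightarrow> 0"
      by (rule tendsto_sandwich[OF _ _ tendsto_const that(4)])
         (use that(1,3) fc nrm_nonneg in \<open>auto intro!: always_eventually\<close>)
    then show ?thesis using that(1,2) by (auto simp: E_iff)
  qed
  have EE: "\<exists>f. (\<forall>n. f n \<in> ?D \<and> f n \<in> carrier A) \<and> (\<lambda>n. nrm A (f n \<ominus> x)) \<longlonglongrightarrow> 0 \<and> x \<in> carrier A"
    if "x \<in> ?E" for x
    using that D by (auto simp: E_iff image_subset_iff)
  have "\<zero> \<in> ?E"
    using EI[of \<zero> "\<lambda>_. \<zero>" "\<lambda>_. 0"] gen_dense_closed(1)[of A G] by (simp add: nrm_zero a_minus_def)
  moreover have "x \<oplus> y \<in> ?E" if "x \<in> ?E" "y \<in> ?E" for x y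
  proof -
    obtain f g where f: "\<And>n. f n \<in> ?D" "\<And>n. f n \<in> carrier A" "(\<lambda>n. nrm A (f n \<ominus> x)) \<longlonglongrightarrow> 0" "x \<in> carrier A"
      and g: "\<And>n. g n \<in> ?D" "\<And>n. g n \<in> carrier A" "(\<lambda>n. nrm A (g n \<ominus> y)) \<longlonglongrightarrow> 0" "y \<in> carrier A"
      using EE[OF \<open>x \<in> ?E\<close>] EE[OF \<open>y \<in> ?E\<close>] by blast
    show ?thesis
    proof (rule EI)
      show "nrm A (f n \<oplus> g n \<ominus> (x \<oplus> y)) \<le> nrm A (f n \<ominus> x) + nrm A (g n \<ominus> y)" for n
        using nrm_triangle[of "f n \<ominus> x" "g n \<ominus> y"] f g by (simp add: minus_add_distrib4)
      show "(\<lambda>n. nrm A (f n \<ominus> x) + nrm A (g n \<ominus> y)) \<longlonglongrightarrow> 0"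
        using tendsto_add[OF f(3) g(3)] by simp
    qed (auto simp: f g intro: gen_dense_closed)
  qed
  moreover have "x \<otimes> y \<in> ?E" if "x \<in> ?E" "y \<in> ?E" for x y
  proof -
    obtain f g where f: "\<And>n. f n \<in> ?D" "\<And>n. f n \<in> carrier A" "(\<lambda>n. nrm A (f n \<ominus> x)) \<longlonglongrightarrow> 0" "x \<in> carrier A"
      and g: "\<And>n. g n \<in> ?D" "\<And>n. g n \<in> carrier A" "(\<lambda>n. nrm A (g n \<ominus> y)) \<longlonglongrightarrow> 0" "y \<in> carrier A"
      using EE[OF \<open>x \<in> ?E\<close>] EE[OF \<open>y \<in> ?E\<close>] by blast
    let ?e = "\<lambda>n. nrm A (f n \<ominus> x) * (nrm A (g n \<ominus> y) + nrm A y) + nrm A x * nrm A (g n \<ominus> y)"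
    show ?thesis
    proof (rule EI)
      show "nrm A (f n \<otimes> g n \<ominus> x \<otimes> y) \<le> ?e n" for n
      proof -
        let ?a = "f n \<ominus> x" and ?b = "g n \<ominus> y"
        have c: "?a \<in> carrier A" "?b \<in> carrier A" using f g by auto
        have fe: "f n = ?a \<oplus> x" and ge: "g n = ?b \<oplus> y"
          using f g by (simp_all add: a_minus_def a_assoc l_neg)
        have "?a \<otimes> (?b \<oplus> y) \<oplus> x \<otimes> ?b \<oplus> x \<otimes> y = (?a \<oplus> x) \<otimes> (?b \<oplus> y)"
          using c f(4) g(4) by (simp add: l_distr r_distr a_ac)
        then have "f n \<otimes> g n = ?a \<otimes> (?b \<oplus> y) \<oplus> x \<otimes> ?b \<oplus> x \<otimes> y"
          using fe ge by metis
        then have e1: "f n \<otimes> g n \<ominus> x \<otimes> y = ?a \<otimes> (?b \<oplus> y) \<oplus> x \<otimes> ?b"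
          using c f(4) g(4) by (simp add: a_minus_def a_assoc r_neg)
        have e2: "nrm A (?a \<otimes> (?b \<oplus> y) \<oplus> x \<otimes> ?b) \<le> nrm A (?a \<otimes> (?b \<oplus> y)) + nrm A (x \<otimes> ?b)"
          using nrm_triangle c f(4) g(4) by simp
        have e3: "nrm A (?a \<otimes> (?b \<oplus> y)) \<le> nrm A ?a * nrm A (?b \<oplus> y)"
          using nrm_mult c f(4) g(4) by simp
        have e4: "nrm A ?a * nrm A (?b \<oplus> y) \<le> nrm A ?a * (nrm A ?b + nrm A y)"
          using c g(4) nrm_triangle nrm_nonneg by (intro mult_left_mono) auto
        have e5: "nrm A (x \<otimes> ?b) \<le> nrm A x * nrm A ?b"
          using nrm_mult c f(4) by simp
        show ?thesis
          unfolding e1 by (rule order_trans[OF e2 add_mono[OF order_trans[OF e3 e4] e5]])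
      qed
      have "?e \<longlonglongrightarrow> 0 * (0 + nrm A y) + nrm A x * 0"
        by (intro tendsto_intros f(3) g(3))
      then show "?e \<longlonglongrightarrow> 0" by simp
    qed (auto simp: f g intro: gen_dense_closed)
  qed
  moreover have "c \<odot> x \<in> ?E" if "x \<in> ?E" for c x
  proof -
    obtain f where f: "\<And>n. f n \<in> ?D" "\<And>n. f n \<in> carrier A" "(\<lambda>n. nrm A (f n \<ominus> x)) \<longlonglongrightarrow> 0" "x \<in> carrier A"
      using EE[OF \<open>x \<in> ?E\<close>] by blast
    obtain p q :: "nat \<Rightarrow> rat" where pq: "(\<lambda>n. Complex (of_rat (p n)) (of_rat (q n))) \<longlonglongrightarrow> c"
      by (rule rat_complex_seq)
    define r where "r n = Complex (of_rat (p n)) (of_rat (q n))" for n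
    have r: "r \<longlonglongrightarrow> c" using pq by (simp add: r_def[abs_def])
    let ?e = "\<lambda>n. cmod (r n) * nrm A (f n \<ominus> x) + cmod (r n - c) * nrm A x"
    show ?thesis
    proof (rule EI)
      show "nrm A (r n \<odot> f n \<ominus> c \<odot> x) \<le> ?e n" for n
      proof -
        let ?a = "f n \<ominus> x"
        have c: "?a \<in> carrier A" using f by auto
        have fe: "f n = ?a \<oplus> x" using f by (simp add: a_minus_def a_assoc l_neg)
        have 1: "r n \<odot> f n = r n \<odot> ?a \<oplus> r n \<odot> x"
          using c f(4) scalar.smult_r_distr[of "r n" ?a x] fe by (simp add: complex_ring_def)
        have 2: "r n \<odot> x = (r n - c) \<odot> x \<oplus> c \<odot> x"
          using f(4) scalar.smult_l_distr[of "r n - c" c x] by (simp add: complex_ring_def)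
        have "r n \<odot> f n \<ominus> c \<odot> x = r n \<odot> ?a \<oplus> (r n - c) \<odot> x"
          unfolding 1 2 using c f(4) by (simp add: a_minus_def a_assoc r_neg)
        then show ?thesis
          using nrm_triangle[of "r n \<odot> ?a" "(r n - c) \<odot> x"] c f(4) by (simp add: nrm_smult)
      qed
      have "?e \<longlonglongrightarrow> cmod c * 0 + cmod (c - c) * nrm A x"
        by (intro tendsto_intros f(3) r)
      then show "?e \<longlonglongrightarrow> 0" by simp
    qed (auto simp: r_def f intro: gen_dense_closed)
  qed
  moreover have "star x \<in> ?E" if "x \<in> ?E" for x
  proof -
    obtain f where f: "\<And>n. f n \<in> ?D" "\<And>n. f n \<in> carrier A" "(\<lambda>n. nrm A (f n \<ominus> x)) \<longlonglongrightarrow> 0" "x \<in> carrier A"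
      using EE[OF \<open>x \<in> ?E\<close>] by blast
    show ?thesis
    proof (rule EI)
      have "star (f n \<ominus> x) = star (f n) \<ominus> star x" for n
        using f by (simp add: a_minus_def minus_eq_smult star_add star_smult)
      then show "nrm A (star (f n) \<ominus> star x) \<le> nrm A (f n \<ominus> x)" for n
        using nrm_star[of "f n \<ominus> x"] f by simp
      show "(\<lambda>n. nrm A (f n \<ominus> x)) \<longlonglongrightarrow> 0" by (rule f(3))
    qed (auto simp: f intro: gen_dense_closed)
  qed
  moreover have "?E \<subseteq> carrier A" by (auto simp: E_iff)
  ultimately show ?thesis by (simp add: cstar_subalgebra_def)
qed

lemma cstar_gen_inj:
  assumes G: "countable G" "G \<subseteq> carrier A"
  shows "\<exists>g :: 'a \<Rightarrow> real. inj_on g (cstar_gen A G)"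
proof -
  interpret M: Metric_space "carrier A" "cdist A" by (rule Metric_space_cdist)
  let ?D = "gen_dense A G"
  let ?E = "ctop A closure_of ?D"
  have D: "?D \<subseteq> carrier A" by (rule gen_dense_carrier[OF G(2)])
  have "?D \<subseteq> ?E" using D by (intro closure_of_subset) simp
  then have "cstar_gen A G \<subseteq> ?E"
    unfolding cstar_gen_def using cstar_subalgebra_closure[OF G(2)] gen_dense_closed(2)[of G A] by auto
  define N where "N x = to_nat_on (?D \<times> (\<rat> :: real set)) ` {(d, r). d \<in> ?D \<and> r \<in> \<rat> \<and> cdist A x d < r}" for x
  have cnt: "countable (?D \<times> (\<rat> :: real set))"
    using countable_gen_dense[OF G(1)] countable_rat by auto
  have le: "x = y" if x: "x \<in> ?E" and y: "y \<in> ?E" and eq: "N x = N y" for x y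
  proof (rule ccontr)
    assume "x \<noteq> y"
    have xy: "x \<in> carrier A" "y \<in> carrier A" using x y by (auto simp: M.metric_closure_of)
    define e where "e = cdist A x y / 2"
    have e: "e > 0" using \<open>x \<noteq> y\<close> xy M.mdist_pos_less by (simp add: e_def)
    obtain r :: real where r: "r \<in> \<rat>" "0 < r" "r < e" using Rats_dense_in_real[OF e] by auto
    obtain d where d: "d \<in> ?D" "cdist A x d < r"
      using x r(2) by (auto simp: M.metric_closure_of M.in_mball)
    have "to_nat_on (?D \<times> (\<rat> :: real set)) (d, r) \<in> N y"
      using d r eq unfolding N_def by auto
    then obtain d' r' where d': "d' \<in> ?D" "r' \<in> \<rat>" "cdist A y d' < r'"
      "to_nat_on (?D \<times> (\<rat> :: real set)) (d, r) = to_nat_on (?D \<times> (\<rat> :: real set)) (d', r')"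
      by (auto simp: N_def)
    then have "(d, r) = (d', r')"
      using to_nat_on_inj[OF cnt] d r by blast
    then have "cdist A y d < r" using d' by simp
    moreover have "cdist A x y \<le> cdist A x d + cdist A d y"
      using M.triangle xy d D by blast
    ultimately show False using d r by (simp add: e_def M.commute)
  qed
  obtain g :: "nat set \<Rightarrow> real" where "inj g"
    using nat_sets_lepoll_reals01 by (auto simp: lepoll_def)
  then have "inj_on (g \<circ> N) ?E" using le by (auto simp: inj_on_def)
  then show ?thesis using \<open>cstar_gen A G \<subseteq> ?E\<close> inj_on_subset by blast
qed

end

lemma covariant_repD:
  assumes "covariant_rep B X"
  shows "\<And>x. x \<in> carrier PN \<Longrightarrow> X x \<in> carrier B" "X \<one>\<^bsub>PN\<^esub> = \<one>\<^bsub>B\<^esub>"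
  using assms unfolding covariant_rep_def isometric_rep_def by blast+

lemma in_PN: "(m, a) \<in> carrier PN \<longleftrightarrow> m \<noteq> 1 \<and> 0 < a"
  by (simp add: PN_def P_def)

lemma translate_ne_1: "m + a * k \<noteq> 1" if "m \<noteq> 1" "k \<noteq> 1" for m a k :: nat
proof
  assume "m + a * k = 1"
  then have "m = 0" "a * k = 1" using that by linarith+
  then show False using that by simp
qed

lemma PN_mult_closed:
  assumes "x \<in> carrier PN" "y \<in> carrier PN" shows "x \<otimes>\<^bsub>PN\<^esub> y \<in> carrier PN"
proof -
  obtain m a n b where xy: "x = (m, a)" "y = (n, b)" by (metis surj_pair)
  have "x \<otimes>\<^bsub>PN\<^esub> y = (m + a * n, a * b)" by (simp add: PN_def xy)
  then show ?thesis using assms translate_ne_1[of m n a] by (simp add: in_PN xy)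
qed

lemma cup_carrier:
  assumes x: "x \<in> carrier PN" and y: "y \<in> carrier PN" and z: "cup x y = Some z"
  shows "z \<in> carrier PN"
proof -
  obtain m a n b where xy: "x = (m, a)" "y = (n, b)" by (metis surj_pair)
  define I where "I = (\<lambda>k. m + a * k) ` P \<inter> (\<lambda>k. n + b * k) ` P"
  have c: "cup x y = (if I = {} then None else Some (LEAST l. l \<in> I, lcm a b))"
    by (simp only: cup_def xy prod.case Let_def I_def)
  define q where "q = (LEAST l. l \<in> I)"
  have ne: "I \<noteq> {}" and zz: "z = (q, lcm a b)"
    using z c unfolding q_def[symmetric] by (simp_all split: if_splits)
  obtain i where "i \<in> I" using ne by blast
  then have "q \<in> I" unfolding q_def by (rule LeastI[of "\<lambda>l. l \<in> I" i])
  then obtain k where k: "q = m + a * k" "k \<in> P" unfolding I_def by blast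
  have "q \<noteq> 1"
    using x k(2) unfolding k(1) by (intro translate_ne_1) (simp_all add: in_PN xy P_def)
  moreover have "0 < lcm a b"
    using x y by (simp add: in_PN xy lcm_pos_nat)
  ultimately show ?thesis unfolding zz in_PN by simp
qed

theorem universal_covariant_rep_any:
  fixes A :: "'a cstar_struct" and B :: "'b cstar_struct"
  assumes univ: "universal_covariant_rep A W"
    and B: "cstar_algebra B" and X: "covariant_rep B X"
  shows "\<exists>h. star_hom A B h \<and> h ` carrier A \<subseteq> cstar_gen B (X ` carrier PN) \<and>
             (\<forall>x\<in>carrier PN. h (W x) = X x)"
proof -
  interpret A: cstar_algebra A using univ by (simp add: universal_covariant_rep_def)
  interpret B: cstar_algebra B by (rule B)
  let ?G = "X ` carrier PN"
  let ?C = "cstar_gen B ?G"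
  have G: "?G \<subseteq> carrier B" using covariant_repD[OF X] by auto
  have C: "cstar_subalgebra B ?C" by (rule B.cstar_subalgebra_gen[OF G])
  have XC: "x \<in> carrier PN \<Longrightarrow> X x \<in> ?C" for x by (auto simp: cstar_gen_def)
  have oPN: "\<one>\<^bsub>PN\<^esub> \<in> carrier PN" by (simp add: PN_def P_def)
  have one: "\<one>\<^bsub>B\<^esub> \<in> ?C" using XC[OF oPN] covariant_repD(2)[OF X] by simp
  obtain g :: "'b \<Rightarrow> real" where g: "inj_on g ?C"
    using B.cstar_gen_inj[OF _ G] by blast
  let ?T = "cstar_transport B ?C g"
  note ops = cstar_transport_ops[OF g, where B = B]
  have cl: "\<zero>\<^bsub>B\<^esub> \<in> ?C" "\<And>x y. x \<in> ?C \<Longrightarrow> y \<in> ?C \<Longrightarrow> x \<oplus>\<^bsub>B\<^esub> y \<in> ?C"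
    "\<And>x y. x \<in> ?C \<Longrightarrow> y \<in> ?C \<Longrightarrow> x \<otimes>\<^bsub>B\<^esub> y \<in> ?C"
    "\<And>c x. x \<in> ?C \<Longrightarrow> c \<odot>\<^bsub>B\<^esub> x \<in> ?C" "\<And>x. x \<in> ?C \<Longrightarrow> star\<^bsub>B\<^esub> x \<in> ?C"
    using C by (auto simp: cstar_subalgebra_def)
  have T: "cstar_algebra ?T" by (rule cstar_algebra_transport[OF B C one g])
  have mPN: "x \<otimes>\<^bsub>PN\<^esub> y \<in> carrier PN" if "x \<in> carrier PN" "y \<in> carrier PN" for x y
    using that by (rule PN_mult_closed)
  have iso: "isometric_rep ?T (g \<circ> X)"
    using X XC oPN mPN unfolding covariant_rep_def isometric_rep_def
    by (auto simp: ops cl)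
  have XT: "covariant_rep ?T (g \<circ> X)"
    unfolding covariant_rep_def
  proof (intro conjI iso ballI)
    fix x y assume xy: "x \<in> carrier PN" "y \<in> carrier PN"
    have eq: "X x \<otimes>\<^bsub>B\<^esub> star\<^bsub>B\<^esub> (X x) \<otimes>\<^bsub>B\<^esub> X y \<otimes>\<^bsub>B\<^esub> star\<^bsub>B\<^esub> (X y) =
        (case cup x y of None \<Rightarrow> \<zero>\<^bsub>B\<^esub> | Some z \<Rightarrow> X z \<otimes>\<^bsub>B\<^esub> star\<^bsub>B\<^esub> (X z))"
      using X xy by (simp add: covariant_rep_def)
    show "(g \<circ> X) x \<otimes>\<^bsub>?T\<^esub> star\<^bsub>?T\<^esub> ((g \<circ> X) x) \<otimes>\<^bsub>?T\<^esub> (g \<circ> X) y \<otimes>\<^bsub>?T\<^esub> star\<^bsub>?T\<^esub> ((g \<circ> X) y) =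
        (case cup x y of None \<Rightarrow> \<zero>\<^bsub>?T\<^esub> | Some z \<Rightarrow> (g \<circ> X) z \<otimes>\<^bsub>?T\<^esub> star\<^bsub>?T\<^esub> ((g \<circ> X) z))"
    proof (cases "cup x y")
      case None
      then show ?thesis using eq xy by (simp add: ops cl XC)
    next
      case (Some z)
      then show ?thesis using eq xy cup_carrier[OF xy Some] by (simp add: ops cl XC)
    qed
  qed
  have "\<exists>h. star_hom A ?T h \<and> (\<forall>x\<in>carrier PN. h (W x) = (g \<circ> X) x)"
    using univ T XT unfolding universal_covariant_rep_def by blast
  then obtain h where h: "star_hom A ?T h" "\<And>x. x \<in> carrier PN \<Longrightarrow> h (W x) = g (X x)"
    by auto
  define k where "k = inv_into ?C g \<circ> h"
  have hT: "h x \<in> g ` ?C" if "x \<in> carrier A" for x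
    using h(1) that by (auto simp: star_hom_def ops)
  have k: "k x \<in> ?C" "h x = g (k x)" if "x \<in> carrier A" for x
    using hT[OF that] by (auto simp: k_def inv_into_into f_inv_into_f)
  have inj: "u = v" if "g u = g v" "u \<in> ?C" "v \<in> ?C" for u v
    using g that by (auto simp: inj_on_def)
  have CB: "u \<in> ?C \<Longrightarrow> u \<in> carrier B" for u using C by (auto simp: cstar_subalgebra_def)
  note hh = h(1)[unfolded star_hom_def]
  have "star_hom A B k"
    unfolding star_hom_def
  proof (intro conjI ballI allI)
    show "k \<in> carrier A \<rightarrow> carrier B" using k CB by blast
    show "k (x \<oplus>\<^bsub>A\<^esub> y) = k x \<oplus>\<^bsub>B\<^esub> k y" if "x \<in> carrier A" "y \<in> carrier A" for x y
    proof (rule inj)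
      have "g (k (x \<oplus>\<^bsub>A\<^esub> y)) = h (x \<oplus>\<^bsub>A\<^esub> y)" using that by (intro k(2)[symmetric]) simp
      also have "\<dots> = h x \<oplus>\<^bsub>?T\<^esub> h y" using hh that by blast
      also have "\<dots> = g (k x) \<oplus>\<^bsub>?T\<^esub> g (k y)" using k(2) that by simp
      also have "\<dots> = g (k x \<oplus>\<^bsub>B\<^esub> k y)" using k(1) that by (simp add: ops)
      finally show "g (k (x \<oplus>\<^bsub>A\<^esub> y)) = g (k x \<oplus>\<^bsub>B\<^esub> k y)" .
    qed (use k(1) cl that in simp_all)
    show "k (x \<otimes>\<^bsub>A\<^esub> y) = k x \<otimes>\<^bsub>B\<^esub> k y" if "x \<in> carrier A" "y \<in> carrier A" for x y
    proof (rule inj)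
      have "g (k (x \<otimes>\<^bsub>A\<^esub> y)) = h (x \<otimes>\<^bsub>A\<^esub> y)" using that by (intro k(2)[symmetric]) simp
      also have "\<dots> = h x \<otimes>\<^bsub>?T\<^esub> h y" using hh that by blast
      also have "\<dots> = g (k x) \<otimes>\<^bsub>?T\<^esub> g (k y)" using k(2) that by simp
      also have "\<dots> = g (k x \<otimes>\<^bsub>B\<^esub> k y)" using k(1) that by (simp add: ops)
      finally show "g (k (x \<otimes>\<^bsub>A\<^esub> y)) = g (k x \<otimes>\<^bsub>B\<^esub> k y)" .
    qed (use k(1) cl that in simp_all)
    show "k (c \<odot>\<^bsub>A\<^esub> x) = c \<odot>\<^bsub>B\<^esub> k x" if "x \<in> carrier A" for c x
    proof (rule inj)
      have "g (k (c \<odot>\<^bsub>A\<^esub> x)) = h (c \<odot>\<^bsub>A\<^esub> x)" using that by (intro k(2)[symmetric]) simp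
      also have "\<dots> = c \<odot>\<^bsub>?T\<^esub> h x" using hh that by blast
      also have "\<dots> = c \<odot>\<^bsub>?T\<^esub> g (k x)" using k(2) that by simp
      also have "\<dots> = g (c \<odot>\<^bsub>B\<^esub> k x)" using k(1) that by (simp add: ops)
      finally show "g (k (c \<odot>\<^bsub>A\<^esub> x)) = g (c \<odot>\<^bsub>B\<^esub> k x)" .
    qed (use k(1) cl that in simp_all)
    show "k (star\<^bsub>A\<^esub> x) = star\<^bsub>B\<^esub> (k x)" if "x \<in> carrier A" for x
    proof (rule inj)
      have "g (k (star\<^bsub>A\<^esub> x)) = h (star\<^bsub>A\<^esub> x)" using that by (intro k(2)[symmetric]) simp
      also have "\<dots> = star\<^bsub>?T\<^esub> (h x)" using hh that by blast
      also have "\<dots> = star\<^bsub>?T\<^esub> (g (k x))" using k(2) that by simp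
      also have "\<dots> = g (star\<^bsub>B\<^esub> (k x))" using k(1) that by (simp add: ops)
      finally show "g (k (star\<^bsub>A\<^esub> x)) = g (star\<^bsub>B\<^esub> (k x))" .
    qed (use k(1) cl that in simp_all)
  qed
  moreover have "k (W x) = X x" if "x \<in> carrier PN" for x
    using h(2)[OF that] XC[OF that] g by (simp add: k_def)
  ultimately show ?thesis using k(1) by blast
qed

end

theory Submission
  imports Defs
begin

text \<open>
  Write \<open>V\<^sub>k = W(k, 1)\<close>.  The element under \<open>\<phi>\<close> is \<open>W(m, a) W(n, b)\<^sup>*\<close>, and every \<open>W(m, a)\<close> is
  an eigenvector of the dynamics with eigenvalue \<open>a\<^sup>i\<^sup>r\<close>.  On eigenvectors the KMS condition becomes
  an algebraic commutation rule (lemma \<open>KMS_commute\<close>), and this rule gives everything.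

  Commuting \<open>W(m, a) W(n, b)\<^sup>*\<close> with the unit scales its value by \<open>(a / b)\<^sup>-\<^sup>\<beta>\<close>, so the value is zero
  when \<open>a \<noteq> b\<close>.  When \<open>a = b\<close>, commuting the two factors with each other produces
  \<open>a\<^sup>-\<^sup>\<beta> \<phi>(W(n, a)\<^sup>* W(m, a))\<close>, which no longer refers to the dynamics.  If \<open>m\<close> and \<open>n\<close> are
  incongruent modulo \<open>a\<close>, the progressions \<open>m + aP\<close> and \<open>n + aP\<close> are disjoint, and covariance makes
  the two ranges orthogonal (lemma \<open>isometries_orthogonal\<close>).  If \<open>m - n = aK\<close>, then
  \<open>W(n, a)\<^sup>* W(m, a) = V\<^sub>l\<^sup>* V\<^sub>k\<close> for all \<open>k, l \<in> P\<close> with \<open>k - l = K\<close> (lemma \<open>adj_W_mult_W\<close>).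

  There is thus freedom in choosing \<open>k\<close> and \<open>l\<close>.  Taking \<open>u = (x\<^sub>1 - x\<^sub>2) + (y\<^sub>1 - y\<^sub>2)\<close> makes the two
  exponents of the theorem equal to \<open>K\<close> and \<open>-K\<close>, so one wants to see \<open>t\<^sup>K s\<^sup>*\<^sup>K = V\<^sub>3\<^sub>K V\<^sub>2\<^sub>K\<^sup>*\<close> for
  \<open>K \<ge> 0\<close>, and its analogue \<open>V\<^sub>-\<^sub>3\<^sub>K\<^sup>* V\<^sub>-\<^sub>2\<^sub>K\<close> for \<open>K < 0\<close>.  Accordingly one takes \<open>(k, l) = (3K, 2K)\<close>,
  or \<open>(-2K, -3K)\<close> for negative \<open>K\<close>; both pairs avoid the gap \<open>1\<close> of \<open>P\<close>.  For \<open>K \<ge> 0\<close> the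
  commutation rule, applied once more to the fixed elements \<open>V\<^sub>k\<close>, corrects the order of the factors.
\<close>

section \<open>Adjoints and unital identities\<close>

context cstar_algebra
begin

lemma star_one: "star \<one> = \<one>"
proof -
  have "star (star \<one> \<otimes> \<one>) = star \<one> \<otimes> \<one>"
    by (subst star_mult) simp_all
  then show ?thesis by simp
qed

lemma star_pow: "x \<in> carrier A \<Longrightarrow> star (x [^] (k :: nat)) = star x [^] k"
  by (induction k) (simp_all add: star_one star_mult flip: nat_pow_Suc2)

lemma smult_smult: "x \<in> carrier A \<Longrightarrow> c \<odot> (d \<odot> x) = (c * d) \<odot> x"
  using scalar.smult_assoc1[of c d x] by (simp add: complex_ring_def)

lemma smult_unit: "x \<in> carrier A \<Longrightarrow> 1 \<odot> x = x"
  using scalar.smult_one[of x] by (simp add: complex_ring_def)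

lemma smult_minus_distrib: "x \<in> carrier A \<Longrightarrow> c \<odot> x \<ominus> d \<odot> x = (c - d) \<odot> x"
proof -
  assume x: "x \<in> carrier A"
  have "(c + (- d)) \<odot> x = c \<odot> x \<oplus> (- d) \<odot> x"
    using scalar.smult_l_distr[of c "- d" x] x by (simp add: complex_ring_def)
  then show ?thesis
    using x by (simp add: a_minus_def minus_eq_smult smult_smult)
qed

section \<open>Orbits of eigenvectors are entire\<close>

text \<open>A complex derivative of a scalar function is also one after multiplication by a fixed vector,
  because the map \<open>w \<mapsto> w c\<close> on scalars scales distances by the norm of \<open>c\<close>.\<close>

lemma entire_map_smult:
  assumes c: "c \<in> carrier A"
    and f: "\<And>z. (f has_field_derivative f' z) (at z)"
  shows "entire_map A (\<lambda>z. f z \<odot> c)"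
proof -
  interpret M: Metric_space "carrier A" "cdist A" by (rule Metric_space_cdist)
  have "limitin (ctop A) (\<lambda>h. (1 / h) \<odot> (f (z + h) \<odot> c \<ominus> f z \<odot> c)) (f' z \<odot> c) (at 0)" for z
  proof -
    have dist_eq: "cdist A ((1 / h) \<odot> (f (z + h) \<odot> c \<ominus> f z \<odot> c)) (f' z \<odot> c)
        = cmod ((f (z + h) - f z) / h - f' z) * nrm A c" for h
      using c by (simp add: cdist_def smult_minus_distrib smult_smult nrm_smult)
    have "((\<lambda>h. (f (z + h) - f z) / h) \<longlongrightarrow> f' z) (at 0)"
      using f[of z] by (simp add: DERIV_def)
    then have "((\<lambda>h. cmod ((f (z + h) - f z) / h - f' z) * nrm A c)
        \<longlongrightarrow> cmod (f' z - f' z) * nrm A c) (at 0)"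
      by (intro tendsto_intros)
    then have lim: "((\<lambda>h. cmod ((f (z + h) - f z) / h - f' z) * nrm A c) \<longlongrightarrow> 0) (at 0)"
      by simp
    show ?thesis
      unfolding M.limitin_metric dist_eq
      using c order_tendstoD(2)[OF lim] by simp
  qed
  then show ?thesis
    unfolding entire_map_def using c by blast
qed

end

text \<open>The one-parameter family of eigenvalues is recorded by its exponent \<open>\<kappa>\<close>, so that products
  of eigenvectors correspond to sums and \<open>W(0, p)\<close> has exponent \<open>ln p\<close>.\<close>

definition eigenvector ::
    "'a cstar_struct \<Rightarrow> (real \<Rightarrow> 'a \<Rightarrow> 'a) \<Rightarrow> real \<Rightarrow> 'a \<Rightarrow> bool" where
  "eigenvector A \<sigma> \<kappa> c \<longleftrightarrow>
     c \<in> carrier A \<and> (\<forall>r. \<sigma> r c = exp (\<i> * of_real (r * \<kappa>)) \<odot>\<^bsub>A\<^esub> c)"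

context cstar_algebra
begin

lemma eigenvector_mult:
  assumes "strongly_continuous_action A \<sigma>"
    and c: "eigenvector A \<sigma> \<kappa> c" and d: "eigenvector A \<sigma> \<mu> d"
  shows "eigenvector A \<sigma> (\<kappa> + \<mu>) (c \<otimes> d)"
proof -
  have cd: "c \<in> carrier A" "d \<in> carrier A"
    using c d by (auto simp: eigenvector_def)
  have "\<sigma> r (c \<otimes> d) = exp (\<i> * of_real (r * (\<kappa> + \<mu>))) \<odot> (c \<otimes> d)" for r
  proof -
    have "\<sigma> r (c \<otimes> d) = \<sigma> r c \<otimes> \<sigma> r d"
      using assms(1) cd by (simp add: strongly_continuous_action_def star_hom_def)
    also have "\<dots> = exp (\<i> * of_real (r * \<kappa>)) \<odot> c \<otimes> (exp (\<i> * of_real (r * \<mu>)) \<odot> d)"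
      using c d by (simp add: eigenvector_def)
    also have "\<dots> = exp (\<i> * of_real (r * (\<kappa> + \<mu>))) \<odot> (c \<otimes> d)"
      using cd by (simp add: smult_mult_left smult_mult_right smult_smult
          exp_add[symmetric] algebra_simps)
    finally show ?thesis .
  qed
  then show ?thesis using cd by (simp add: eigenvector_def)
qed

lemma eigenvector_star:
  assumes "strongly_continuous_action A \<sigma>" and c: "eigenvector A \<sigma> \<kappa> c"
  shows "eigenvector A \<sigma> (- \<kappa>) (star c)"
proof -
  have cc: "c \<in> carrier A" using c by (simp add: eigenvector_def)
  have "\<sigma> r (star c) = exp (\<i> * of_real (r * - \<kappa>)) \<odot> star c" for r
  proof -
    have "\<sigma> r (star c) = star (\<sigma> r c)"
      using assms(1) cc by (simp add: strongly_continuous_action_def star_hom_def)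
    also have "\<dots> = star (exp (\<i> * of_real (r * \<kappa>)) \<odot> c)"
      using c by (simp add: eigenvector_def)
    finally show ?thesis using cc by (simp add: star_smult exp_cnj)
  qed
  then show ?thesis using cc by (simp add: eigenvector_def)
qed

text \<open>An automorphism of the algebra preserves the unit, since the image of the unit is a unit for
  the whole (surjective) image.\<close>

lemma eigenvector_one:
  assumes "strongly_continuous_action A \<sigma>"
  shows "eigenvector A \<sigma> 0 \<one>"
proof -
  have "\<sigma> r \<one> = \<one>" for r
  proof -
    have hom: "star_hom A A (\<sigma> r)" and bij: "bij_betw (\<sigma> r) (carrier A) (carrier A)"
      using assms by (auto simp: strongly_continuous_action_def)
    obtain e where e: "e \<in> carrier A" "\<sigma> r e = \<one>"
      using bij one_closed unfolding bij_betw_def by (metis imageE)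
    have "\<sigma> r (\<one> \<otimes> e) = \<sigma> r \<one> \<otimes> \<sigma> r e"
      using hom e(1) one_closed unfolding star_hom_def by blast
    moreover have "\<sigma> r \<one> \<in> carrier A"
      using hom unfolding star_hom_def by blast
    ultimately show ?thesis using e by simp
  qed
  then show ?thesis by (simp add: eigenvector_def smult_unit)
qed

lemma eigenvector_entire_extension:
  assumes "eigenvector A \<sigma> \<kappa> c"
  shows "entire_extension A \<sigma> c (\<lambda>z. exp (\<i> * z * of_real \<kappa>) \<odot> c)"
  unfolding entire_extension_def
proof
  show "entire_map A (\<lambda>z. exp (\<i> * z * of_real \<kappa>) \<odot> c)"
    using assms
    by (intro entire_map_smult[where f' = "\<lambda>z. exp (\<i> * z * of_real \<kappa>) * (\<i> * of_real \<kappa>)"])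
      (auto simp: eigenvector_def intro!: derivative_eq_intros)
  show "\<forall>r. exp (\<i> * of_real r * of_real \<kappa>) \<odot> c = \<sigma> r c"
    using assms by (simp add: eigenvector_def mult.assoc)
qed

text \<open>The analytic continuation of \<open>e\<^sup>i\<^sup>r\<^sup>\<kappa> c\<close> to the point \<open>i\<beta>\<close> is the real multiple
  \<open>e\<^sup>-\<^sup>\<beta>\<^sup>\<kappa> c\<close>, so the KMS condition lets an eigenvector pass from one side to the other at the cost
  of this factor.\<close>

lemma KMS_commute:
  assumes "KMS_state A \<sigma> \<beta> \<phi>"
    and c: "eigenvector A \<sigma> \<kappa> c" and d: "eigenvector A \<sigma> \<mu> d"
  shows "\<phi> (c \<otimes> d) = of_real (exp (- \<beta> * \<kappa>)) * \<phi> (d \<otimes> c)"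
proof -
  have cd: "c \<in> carrier A" "d \<in> carrier A"
    using c d by (auto simp: eigenvector_def)
  have "analytic_element A \<sigma> c" "analytic_element A \<sigma> d"
    using cd eigenvector_entire_extension[OF c] eigenvector_entire_extension[OF d]
    by (auto simp: analytic_element_def)
  then have "\<phi> (c \<otimes> d) = \<phi> (d \<otimes> (exp (\<i> * (\<i> * of_real \<beta>) * of_real \<kappa>) \<odot> c))"
    using assms(1) eigenvector_entire_extension[OF c] unfolding KMS_state_def by blast
  also have "exp (\<i> * (\<i> * of_real \<beta>) * of_real \<kappa>) = complex_of_real (exp (- \<beta> * \<kappa>))"
    by (simp add: mult.assoc[symmetric] flip: exp_of_real)
  finally show ?thesis
    using assms(1) cd by (simp add: smult_mult_right KMS_state_def cstar_state_def)
qed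

text \<open>This is the invariance of a KMS state under the dynamics, read off on eigenvectors.\<close>

lemma KMS_eigenvector_eq_0:
  assumes \<sigma>: "strongly_continuous_action A \<sigma>" and \<phi>: "KMS_state A \<sigma> \<beta> \<phi>"
    and c: "eigenvector A \<sigma> \<kappa> c" and "\<beta> \<noteq> 0" "\<kappa> \<noteq> 0"
  shows "\<phi> c = 0"
proof -
  have "c \<in> carrier A" using c by (simp add: eigenvector_def)
  then have "\<phi> c = of_real (exp (- \<beta> * \<kappa>)) * \<phi> c"
    using KMS_commute[OF \<phi> c eigenvector_one[OF \<sigma>]] by simp
  moreover have "exp (- \<beta> * \<kappa>) \<noteq> 1"
    using assms(4,5) by simp
  ultimately show ?thesis
    by (metis mult_cancel_right2 of_real_eq_1_iff)
qed

end

section \<open>Products of the canonical isometries\<close>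

locale semigroup_rep = cstar_algebra A for A :: "'a cstar_struct" (structure) +
  fixes W :: "nat \<times> nat \<Rightarrow> 'a"
  assumes isometric: "isometric_rep A W"
begin

lemma W_closed: "m \<noteq> 1 \<Longrightarrow> 0 < a \<Longrightarrow> W (m, a) \<in> carrier A"
  using isometric by (auto simp: isometric_rep_def in_PN Pi_iff)

lemma star_W_mult_same: "m \<noteq> 1 \<Longrightarrow> 0 < a \<Longrightarrow> star (W (m, a)) \<otimes> W (m, a) = \<one>"
  using isometric by (simp add: isometric_rep_def in_PN)

lemma W_one: "W (0, 1) = \<one>"
  using isometric by (simp add: isometric_rep_def PN_def)

lemma W_mult:
  assumes "m \<noteq> 1" "0 < a" "n \<noteq> 1" "0 < b"
  shows "W (m, a) \<otimes> W (n, b) = W (m + a * n, a * b)"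
proof -
  have "W ((m, a) \<otimes>\<^bsub>PN\<^esub> (n, b)) = W (m, a) \<otimes> W (n, b)"
    using isometric assms by (simp add: isometric_rep_def in_PN)
  then show ?thesis by (simp add: PN_def)
qed

lemma W_pow:
  assumes "k \<noteq> 1"
  shows "W (k, 1) [^] (j :: nat) = W (k * j, 1)"
proof (induction j)
  case 0
  then show ?case using W_one by simp
next
  case (Suc j)
  have "k * j \<noteq> 1" using assms by simp
  then show ?case using Suc assms W_mult[of "k * j" 1 k 1] by (simp add: add.commute)
qed

lemma W_two_pow_mult_three_pow:
  "W (2, 1) [^] (x :: nat) \<otimes> W (3, 1) [^] (y :: nat) = W (2 * x + 3 * y, 1)"
  using W_mult[of "2 * x" 1 "3 * y" 1] W_pow[of 2 x] W_pow[of 3 y] by simp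

lemma word_eq_W_star_W:
  assumes "0 < a" "0 < b" and m: "m = 2 * x\<^sub>1 + 3 * y\<^sub>1" and n: "n = 2 * x\<^sub>2 + 3 * y\<^sub>2"
  shows "W (2, 1) [^] x\<^sub>1 \<otimes> W (3, 1) [^] y\<^sub>1 \<otimes> W (0, a) \<otimes> star (W (0, b))
      \<otimes> star (W (3, 1)) [^] y\<^sub>2 \<otimes> star (W (2, 1)) [^] x\<^sub>2 = W (m, a) \<otimes> star (W (n, b))"
proof -
  have m1: "m \<noteq> 1" and n1: "n \<noteq> 1" unfolding m n by presburger+
  have cl: "W (2, 1) \<in> carrier A" "W (3, 1) \<in> carrier A" "W (0, b) \<in> carrier A"
    "W (m, a) \<in> carrier A"
    using assms(1,2) m1 by (simp_all add: W_closed)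
  have left: "W (2, 1) [^] x\<^sub>1 \<otimes> W (3, 1) [^] y\<^sub>1 \<otimes> W (0, a) = W (m, a)"
    unfolding W_two_pow_mult_three_pow m[symmetric]
    using assms(1) m1 W_mult[of m 1 0 a] by simp
  have "star (W (n, b)) = star (W (2, 1) [^] x\<^sub>2 \<otimes> W (3, 1) [^] y\<^sub>2 \<otimes> W (0, b))"
    unfolding W_two_pow_mult_three_pow n[symmetric]
    using assms(2) n1 W_mult[of n 1 0 b] by simp
  also have "\<dots> = star (W (0, b)) \<otimes> star (W (3, 1)) [^] y\<^sub>2 \<otimes> star (W (2, 1)) [^] x\<^sub>2"
    using cl by (simp add: star_mult star_pow m_assoc)
  finally show ?thesis
    unfolding left using cl by (simp add: m_assoc)
qed

text \<open>The isometry \<open>V = W(al, 1)\<close> satisfies \<open>V W(n, a) = W(n, a) W(l, 1)\<close>, and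
  \<open>V W(m, a) = W(n, a) W(k, 1)\<close> because \<open>m + al = n + ak\<close>.  Inserting \<open>V\<^sup>* V = 1\<close> between the two
  factors therefore replaces them by \<open>W(n, a) W(l, 1)\<close> and \<open>W(n, a) W(k, 1)\<close>, and \<open>W(n, a)\<close>
  cancels.  The detour through \<open>V\<close> is what covers the case \<open>m - n = a\<close>, where
  \<open>W(m, a) = W(n, a) W(k, 1)\<close> would need the gap \<open>k = 1\<close> of \<open>P\<close>.\<close>

lemma adj_W_mult_W:
  assumes "m \<noteq> 1" "n \<noteq> 1" "k \<noteq> 1" "l \<noteq> 1" "0 < a" and eq: "m + a * l = n + a * k"
  shows "star (W (n, a)) \<otimes> W (m, a) = star (W (l, 1)) \<otimes> W (k, 1)"
proof -
  let ?V = "W (a * l, 1)" and ?M = "W (m, a)" and ?N = "W (n, a)"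
    and ?K = "W (k, 1)" and ?L = "W (l, 1)"
  have al: "a * l \<noteq> 1" using assms(4) by simp
  have cl: "?V \<in> carrier A" "?M \<in> carrier A" "?N \<in> carrier A" "?K \<in> carrier A" "?L \<in> carrier A"
    using assms al by (simp_all add: W_closed)
  have VM: "?V \<otimes> ?M = ?N \<otimes> ?K"
    using assms al W_mult[of "a * l" 1 m a] W_mult[of n a k 1] by (simp add: add.commute)
  have VN: "?V \<otimes> ?N = ?N \<otimes> ?L"
    using assms al W_mult[of "a * l" 1 n a] W_mult[of n a l 1] by (simp add: add.commute)
  have "star ?N \<otimes> ?M = star ?N \<otimes> (star ?V \<otimes> ?V) \<otimes> ?M"
    using al cl by (simp add: star_W_mult_same)
  also have "\<dots> = star (?V \<otimes> ?N) \<otimes> (?V \<otimes> ?M)"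
    using cl by (simp add: star_mult m_assoc)
  also have "\<dots> = star ?L \<otimes> (star ?N \<otimes> ?N) \<otimes> ?K"
    unfolding VM VN using cl by (simp add: star_mult m_assoc)
  also have "\<dots> = star ?L \<otimes> ?K"
    using assms(2,5) cl by (simp add: star_W_mult_same)
  finally show ?thesis .
qed

text \<open>Covariance says that the range projections multiply to zero when the progressions
  \<open>n + aP\<close> and \<open>m + aP\<close> are disjoint; the isometries can then be stripped off on either side.\<close>

lemma isometries_orthogonal:
  assumes cov: "covariant_rep A W"
    and "m \<noteq> 1" "n \<noteq> 1" "0 < a" and "\<not> [m = n] (mod a)"
  shows "star (W (n, a)) \<otimes> W (m, a) = \<zero>"
proof -
  let ?M = "W (m, a)" and ?N = "W (n, a)"
  have cl: "?M \<in> carrier A" "?N \<in> carrier A"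
    using assms by (simp_all add: W_closed)
  have "n + a * k \<noteq> m + a * j" for j k
    using assms(5) by (metis cong_add_lcancel_0_nat cong_def mod_mult_self2)
  then have "(\<lambda>k. n + a * k) ` P \<inter> (\<lambda>k. m + a * k) ` P = {}" by blast
  then have "cup (n, a) (m, a) = None" by (simp add: cup_def)
  then have "?N \<otimes> star ?N \<otimes> ?M \<otimes> star ?M = \<zero>"
    using cov assms(2-4) unfolding covariant_rep_def by (auto simp: in_PN)
  then have "star ?N \<otimes> (?N \<otimes> star ?N \<otimes> ?M \<otimes> star ?M) \<otimes> ?M = \<zero>"
    using cl by simp
  moreover have "star ?N \<otimes> (?N \<otimes> star ?N \<otimes> ?M \<otimes> star ?M) \<otimes> ?M
      = (star ?N \<otimes> ?N) \<otimes> (star ?N \<otimes> ?M) \<otimes> (star ?M \<otimes> ?M)"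
    using cl by (simp add: m_assoc)
  ultimately show ?thesis
    using cl assms(2-4) by (simp add: star_W_mult_same)
qed

section \<open>The canonical isometries as eigenvectors\<close>

lemma eigenvector_W_additive:
  assumes \<sigma>: "canonical_dynamics A W \<sigma>"
  shows "eigenvector A \<sigma> 0 (W (2 * x + 3 * y, 1))"
proof -
  have action: "strongly_continuous_action A \<sigma>"
    using \<sigma> by (simp add: canonical_dynamics_def)
  have gen: "eigenvector A \<sigma> 0 (W (2, 1))" "eigenvector A \<sigma> 0 (W (3, 1))"
    using \<sigma> by (simp_all add: canonical_dynamics_def eigenvector_def W_closed smult_unit)
  have pow: "eigenvector A \<sigma> 0 (c [^] (j :: nat))" if c: "eigenvector A \<sigma> 0 c" for c j
  proof (induction j)
    case 0
    then show ?case using eigenvector_one[OF action] by simp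
  next
    case (Suc j)
    then show ?case using eigenvector_mult[OF action Suc c] by simp
  qed
  show ?thesis
    using eigenvector_mult[OF action pow[OF gen(1), of x] pow[OF gen(2), of y]]
    unfolding W_two_pow_mult_three_pow by simp
qed

lemma eigenvector_W_multiplicative:
  assumes \<sigma>: "canonical_dynamics A W \<sigma>" and "0 < a"
  shows "eigenvector A \<sigma> (ln (real a)) (W (0, a))"
  using assms(2)
proof (induction a rule: prime_divisors_induct)
  case zero
  then show ?case by simp
next
  case (unit a)
  have "strongly_continuous_action A \<sigma>"
    using \<sigma> by (simp add: canonical_dynamics_def)
  then show ?case using unit eigenvector_one[of \<sigma>] W_one by simp
next
  case (factor p a)
  have action: "strongly_continuous_action A \<sigma>"
    using \<sigma> by (simp add: canonical_dynamics_def)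
  have a: "0 < a" and p: "0 < p" using factor by (auto simp: prime_gt_0_nat)
  have "eigenvector A \<sigma> (ln (real p)) (W (0, p))"
    unfolding eigenvector_def
  proof (intro conjI allI)
    show "W (0, p) \<in> carrier A" using p by (simp add: W_closed)
    fix r
    have "(of_nat p :: complex) powr (\<i> * of_real r) = exp (\<i> * of_real (r * ln (real p)))"
      using p Ln_of_nat[of p] by (simp add: powr_def mult_ac)
    then show "\<sigma> r (W (0, p)) = exp (\<i> * of_real (r * ln (real p))) \<odot> W (0, p)"
      using \<sigma> factor by (simp add: canonical_dynamics_def)
  qed
  then show ?case
    using eigenvector_mult[OF action _ factor(2)[OF a], of "ln (real p)" "W (0, p)"]
      a p W_mult[of 0 p 0 a]
    by (simp add: ln_mult)
qed

text \<open>The first coordinate contributes nothing, since \<open>2\<close> and \<open>3\<close> generate \<open>P\<close> and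
  the dynamics fixes \<open>W(2, 1)\<close> and \<open>W(3, 1)\<close>.\<close>

lemma eigenvector_W:
  assumes \<sigma>: "canonical_dynamics A W \<sigma>" and "m \<noteq> 1" "0 < a"
  shows "eigenvector A \<sigma> (ln (real a)) (W (m, a))"
proof -
  have "\<exists>x y. m = 2 * x + 3 * y"
    using assms(2) by presburger
  then obtain x y where m: "m = 2 * x + 3 * y" by blast
  have "strongly_continuous_action A \<sigma>"
    using \<sigma> by (simp add: canonical_dynamics_def)
  then have "eigenvector A \<sigma> (0 + ln (real a)) (W (m, 1) \<otimes> W (0, a))"
    using eigenvector_mult eigenvector_W_additive[OF \<sigma>, of x y]
      eigenvector_W_multiplicative[OF \<sigma> assms(3)] unfolding m by blast
  then show ?thesis using W_mult[of m 1 0 a] assms by simp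
qed

section \<open>Values of a KMS state\<close>

lemma KMS_W_star_W:
  assumes \<sigma>: "canonical_dynamics A W \<sigma>" and \<phi>: "KMS_state A \<sigma> \<beta> \<phi>"
    and "m \<noteq> 1" "n \<noteq> 1" "0 < a"
  shows "\<phi> (W (m, a) \<otimes> star (W (n, a)))
      = of_real (real a powr (- \<beta>)) * \<phi> (star (W (n, a)) \<otimes> W (m, a))"
proof -
  have action: "strongly_continuous_action A \<sigma>"
    using \<sigma> by (simp add: canonical_dynamics_def)
  have "real a powr (- \<beta>) = exp (- \<beta> * ln (real a))"
    using assms(5) by (simp add: powr_def)
  then show ?thesis
    using KMS_commute[OF \<phi> eigenvector_W[OF \<sigma> assms(3,5)]
        eigenvector_star[OF action eigenvector_W[OF \<sigma> assms(4,5)]]] by simp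
qed

text \<open>The parameters are \<open>k = 3K, l = 2K\<close> for \<open>K \<ge> 0\<close> and \<open>k = -2K, l = -3K\<close> otherwise.  In the
  first case \<open>\<phi>\<close> has to be applied, because \<open>t\<^sup>K s\<^sup>*\<^sup>K\<close> has its factors in the wrong order.\<close>

lemma KMS_star_W_mult_W:
  assumes \<sigma>: "canonical_dynamics A W \<sigma>" and \<phi>: "KMS_state A \<sigma> \<beta> \<phi>"
    and "m \<noteq> 1" "n \<noteq> 1" "0 < a" and K: "int m - int n = int a * K"
  shows "\<phi> (star (W (n, a)) \<otimes> W (m, a)) = \<phi> (ipow A (W (3, 1)) K \<otimes> ipow A (W (2, 1)) (- K))"
proof (cases "0 \<le> K")
  case True
  then obtain j where j: "K = int j" using nonneg_int_cases by blast
  have "int (m + a * (2 * j)) = int (n + a * (3 * j))"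
    using K by (simp add: j algebra_simps)
  then have eq: "m + a * (2 * j) = n + a * (3 * j)" by linarith
  have ne: "3 * j \<noteq> 1" "2 * j \<noteq> 1" by presburger+
  have "\<phi> (star (W (n, a)) \<otimes> W (m, a)) = \<phi> (star (W (2 * j, 1)) \<otimes> W (3 * j, 1))"
    using adj_W_mult_W[OF assms(3,4) ne assms(5) eq] by simp
  also have "\<dots> = \<phi> (W (3 * j, 1) \<otimes> star (W (2 * j, 1)))"
    using KMS_W_star_W[OF \<sigma> \<phi> ne] by simp
  also have "W (3 * j, 1) \<otimes> star (W (2 * j, 1)) = ipow A (W (3, 1)) K \<otimes> ipow A (W (2, 1)) (- K)"
    using W_pow[of 2 j] W_pow[of 3 j] W_closed[of 2 1] star_pow[of "W (2, 1)" j]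
    by (simp add: j ipow_def)
  finally show ?thesis .
next
  case False
  then obtain j where j: "K = - int j" "0 < j"
    by (metis linorder_not_le neg_int_cases)
  have "int (m + a * (3 * j)) = int (n + a * (2 * j))"
    using K by (simp add: j algebra_simps)
  then have eq: "m + a * (3 * j) = n + a * (2 * j)" by linarith
  have ne: "2 * j \<noteq> 1" "3 * j \<noteq> 1" by presburger+
  have "star (W (3 * j, 1)) \<otimes> W (2 * j, 1) = ipow A (W (3, 1)) K \<otimes> ipow A (W (2, 1)) (- K)"
    using j(2) W_pow[of 2 j] W_pow[of 3 j] W_closed[of 3 1] star_pow[of "W (3, 1)" j]
    by (simp add: j(1) ipow_def)
  then show ?thesis
    using adj_W_mult_W[OF assms(3,4) ne assms(5) eq] by simp
qed

end

theorem theorem4p3: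
  fixes A :: "'a cstar_struct" (structure)
    and W :: "nat \<times> nat \<Rightarrow> 'a"
    and \<sigma> :: "real \<Rightarrow> 'a \<Rightarrow> 'a"
    and \<phi> :: "'a \<Rightarrow> complex"
    and \<beta> :: real
    and s t :: 'a and \<upsilon> :: "nat \<Rightarrow> 'a"
    and a b m n x\<^sub>1 y\<^sub>1 x\<^sub>2 y\<^sub>2 :: nat
  assumes "universal_covariant_rep A W"
    and "canonical_dynamics A W \<sigma>"
    and "s = W (2, 1)" and "t = W (3, 1)" and "\<And>k. \<upsilon> k = W (0, k)"
    and "1 \<le> \<beta>" and "KMS_state A \<sigma> \<beta> \<phi>"
    and "0 < a" and "0 < b" and "m \<in> P" and "n \<in> P"
    and "m = 2 * x\<^sub>1 + 3 * y\<^sub>1" and "n = 2 * x\<^sub>2 + 3 * y\<^sub>2"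
  shows "(a \<noteq> b \<or> \<not> [m = n] (mod a) \<longrightarrow>
            \<phi> (s [^] x\<^sub>1 \<otimes> t [^] y\<^sub>1 \<otimes> \<upsilon> a \<otimes> star (\<upsilon> b) \<otimes> (star t) [^] y\<^sub>2 \<otimes> (star s) [^] x\<^sub>2) = 0) \<and>
         (a = b \<and> [m = n] (mod a) \<longrightarrow>
            (\<exists>u :: int.
               int a dvd int y\<^sub>1 - int y\<^sub>2 + 2 * u \<and>
               int a dvd int x\<^sub>1 - int x\<^sub>2 - 3 * u \<and>
               \<phi> (s [^] x\<^sub>1 \<otimes> t [^] y\<^sub>1 \<otimes> \<upsilon> a \<otimes> star (\<upsilon> b) \<otimes> (star t) [^] y\<^sub>2 \<otimes> (star s) [^] x\<^sub>2) =
               of_real (real a powr (- \<beta>)) *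
               \<phi> (ipow A t ((int y\<^sub>1 - int y\<^sub>2 + 2 * u) div int a) \<otimes>
                   ipow A s ((int x\<^sub>1 - int x\<^sub>2 - 3 * u) div int a))))"
proof -
  have cov: "covariant_rep A W" and alg: "cstar_algebra A"
    using assms(1) by (simp_all add: universal_covariant_rep_def)
  interpret cstar_algebra A by (rule alg)
  interpret semigroup_rep A W
    by unfold_locales (use cov in \<open>simp add: covariant_rep_def\<close>)
  note \<sigma> = assms(2) and \<phi> = assms(7)
  have action: "strongly_continuous_action A \<sigma>"
    using \<sigma> by (simp add: canonical_dynamics_def)
  have m1: "m \<noteq> 1" and n1: "n \<noteq> 1"
    using assms(10,11) by (simp_all add: P_def)
  have word: "s [^] x\<^sub>1 \<otimes> t [^] y\<^sub>1 \<otimes> \<upsilon> a \<otimes> star (\<upsilon> b) \<otimes> (star t) [^] y\<^sub>2 \<otimes> (star s) [^] x\<^sub>2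
      = W (m, a) \<otimes> star (W (n, b))" (is "?w = _")
    unfolding assms(3,4,5) using assms(8,9,12,13) by (rule word_eq_W_star_W)
  have "\<phi> ?w = 0" if "a \<noteq> b"
  proof -
    have "eigenvector A \<sigma> (ln (real a) + - ln (real b)) (W (m, a) \<otimes> star (W (n, b)))"
      by (intro eigenvector_mult eigenvector_star eigenvector_W action \<sigma> m1 n1 assms(8,9))
    moreover have "ln (real a) + - ln (real b) \<noteq> 0"
      using that assms(8,9) by simp
    ultimately show ?thesis
      unfolding word using KMS_eigenvector_eq_0[OF action \<phi>] assms(6) by fastforce
  qed
  moreover have "\<phi> ?w = 0" if "a = b" "\<not> [m = n] (mod a)"
  proof -
    have "\<phi> \<zero> = 0"
    proof -
      have "\<phi> (\<zero> \<oplus> \<zero>) = \<phi> \<zero> + \<phi> \<zero>"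
        using \<phi> zero_closed unfolding KMS_state_def cstar_state_def by blast
      then show ?thesis by simp
    qed
    then show ?thesis
      using KMS_W_star_W[OF \<sigma> \<phi> m1 n1 assms(8)]
        isometries_orthogonal[OF cov m1 n1 assms(8) that(2)]
      unfolding word by (simp flip: that(1))
  qed
  moreover have "\<exists>u :: int. int a dvd int y\<^sub>1 - int y\<^sub>2 + 2 * u \<and> int a dvd int x\<^sub>1 - int x\<^sub>2 - 3 * u \<and>
      \<phi> ?w = of_real (real a powr (- \<beta>)) *
        \<phi> (ipow A t ((int y\<^sub>1 - int y\<^sub>2 + 2 * u) div int a) \<otimes>
           ipow A s ((int x\<^sub>1 - int x\<^sub>2 - 3 * u) div int a))"
    if "a = b" "[m = n] (mod a)"
  proof -
    have "[int m = int n] (mod int a)"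
      using that(2) by (simp add: cong_int_iff)
    then obtain K where K: "int m - int n = int a * K"
      by (auto simp: cong_iff_dvd_diff elim: dvdE)
    define u where "u = (int x\<^sub>1 - int x\<^sub>2) + (int y\<^sub>1 - int y\<^sub>2)"
    \<comment> \<open>Both numbers are \<open>2 (x\<^sub>1 - x\<^sub>2) + 3 (y\<^sub>1 - y\<^sub>2) = m - n\<close> up to sign; this is why
      \<open>u\<close> is chosen so.\<close>
    have y: "int y\<^sub>1 - int y\<^sub>2 + 2 * u = int a * K" and x: "int x\<^sub>1 - int x\<^sub>2 - 3 * u = int a * (- K)"
      using K by (simp_all add: u_def assms(12,13))
    have "\<phi> (W (m, a) \<otimes> star (W (n, a))) =
        of_real (real a powr (- \<beta>)) * \<phi> (ipow A t K \<otimes> ipow A s (- K))"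
      using KMS_W_star_W[OF \<sigma> \<phi> m1 n1 assms(8)] KMS_star_W_mult_W[OF \<sigma> \<phi> m1 n1 assms(8) K]
      by (simp only: assms(3,4))
    then have "\<phi> ?w = of_real (real a powr (- \<beta>)) * \<phi> (ipow A t K \<otimes> ipow A s (- K))"
      unfolding word by (simp flip: that(1))
    moreover have "(int a * j) div int a = j" for j
      using assms(8) by simp
    ultimately show ?thesis
      by (intro exI[of _ u]) (simp only: y x dvd_triv_left)
  qed
  ultimately show ?thesis by blast
qed

end
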